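(* Let $n\ge 2$ and consider the evolution equation $$\frac{\partial u}{\partial t}=F(t,u,u_1,\dots,u_n).$$ Let $G$ be any symmetry of this equation, of order $k$. Then there exist an integer $s$ with $0\le s\le r_{k,n,1}$ and functions $\psi$, $g_0,\dots,g_s$ such that $$G=\psi(t,x,u,u_1)+\sum_{j=0}^{s}x^{j}\,g_j(t,u,\dots,u_{k-j(n-1)}).$$ Here $$r_{k,n,1}=\begin{cases}\left[\dfrac{k}{n-1}\right] & \text{if } k\not\equiv 0,1 \pmod{n-1},\\[2mm] \max\left(0,\left[\dfrac{k}{n-1}\right]-1\right) & \text{if } k\equiv 0 \text{ or } k\equiv 1 \pmod{n-1},\end{cases}$$ and $[a]$ denotes the integer part of $a$.
   Context: Here $u=u(x,t)$ is a scalar unknown, $u_l=\partial^l u/\partial x^l$ and $u_0\equiv u$. The quantities $x,t,u,u_1,u_2,\dots$ are treated as independent variables (jet coordinates). All functions are sufficiently smooth, each depends on finitely many of these variables, and $\partial F/\partial u_n\neq 0$. Note that $F$ does not depend explicitly on $x$. The total $x$-derivative is $D=\frac{\partial}{\partial x}+\sum_{i\ge 0}u_{i+1}\frac{\partial}{\partial u_i}$. For a function $h(x,t,u,\dots,u_r)$ put $h_*=\sum_{i=0}^{r}\frac{\partial h}{\partial u_i}D^i$. The bracket is $\{h,r\}=h_*(r)-r_*(h)$. A symmetry of the equation $\partial u/\partial t=F$ is a function $G(x,t,u,u_1,\dots,u_k)$, for some finite $k$, such that the equation $\partial u/\partial\tau=G$ is compatible with $\partial u/\partial t=F$; equivalently,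 $\partial G/\partial t=\{F,G\}$, where $\partial/\partial t$ is the partial derivative with respect to the explicit variable $t$. The order ${\rm ord}\,G$ is the largest $k$ such that $\partial G/\partial u_k\ne 0$. If $G$ does not depend on $u,u_1,\dots$, then ${\rm ord}\,G=0$. *)

theory Defs
  imports "HOL-Analysis.Analysis" "HOL-Number_Theory.Cong"
begin

text \<open>
  The jet coordinates \<open>x\<close>, \<open>t\<close>, \<open>u\<^sub>i\<close> (with \<open>u\<^sub>0 = u\<close>) are independent real variables. A point of
  jet space assigns a value to each of them. The type of jets carries the product topology, in which
  a function of finitely many coordinates is continuous iff it is so in these coordinates.
\<close>

datatype jet_var = VarX | VarT | VarU nat

type_synonym jet = "jet_var \<Rightarrow> real"

text \<open>
  Functions are considered on a product of open intervals, bounded or not, one for each coordinate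
  (in particular on all of jet space).
\<close>

definition jet_domain :: "jet set \<Rightarrow> bool" where
  "jet_domain \<Omega> \<longleftrightarrow>
     (\<exists>B. (\<forall>v. open (B v) \<and> is_interval (B v) \<and> B v \<noteq> {}) \<and> \<Omega> = {p. \<forall>v. p v \<in> B v})"

definition pdiff :: "jet_var \<Rightarrow> (jet \<Rightarrow> real) \<Rightarrow> jet \<Rightarrow> real" where
  "pdiff v f p = deriv (\<lambda>y. f (p(v := y))) (p v)"

text \<open>Infinite differentiability: all iterated partial derivatives exist and are continuous.\<close>

definition jet_smooth :: "jet set \<Rightarrow> (jet \<Rightarrow> real) \<Rightarrow> bool" where
  "jet_smooth \<Omega> f \<longleftrightarrow>
     (\<forall>vs. continuous_on \<Omega> (foldr pdiff vs f) \<and>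
           (\<forall>v. \<forall>p\<in>\<Omega>. (\<lambda>y. foldr pdiff vs f (p(v := y))) differentiable at (p v)))"

definition depends_only_on :: "jet set \<Rightarrow> jet_var set \<Rightarrow> (jet \<Rightarrow> real) \<Rightarrow> bool" where
  "depends_only_on \<Omega> V f \<longleftrightarrow> (\<forall>p\<in>\<Omega>. \<forall>q\<in>\<Omega>. (\<forall>v\<in>V. p v = q v) \<longrightarrow> f p = f q)"

definition jet_function :: "jet set \<Rightarrow> jet_var set \<Rightarrow> (jet \<Rightarrow> real) \<Rightarrow> bool" where
  "jet_function \<Omega> V f \<longleftrightarrow> jet_smooth \<Omega> f \<and> depends_only_on \<Omega> V f"

text \<open>
  For functions of finitely many coordinates only finitely many terms of the following two series
  are nonzero, so they are the usual finite sums.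
\<close>

definition total_deriv :: "(jet \<Rightarrow> real) \<Rightarrow> jet \<Rightarrow> real" where
  "total_deriv h p = pdiff VarX h p + (\<Sum>i. p (VarU (Suc i)) * pdiff (VarU i) h p)"

definition frechet :: "(jet \<Rightarrow> real) \<Rightarrow> (jet \<Rightarrow> real) \<Rightarrow> jet \<Rightarrow> real" where
  "frechet h r p = (\<Sum>i. pdiff (VarU i) h p * (total_deriv ^^ i) r p)"

definition jet_bracket :: "(jet \<Rightarrow> real) \<Rightarrow> (jet \<Rightarrow> real) \<Rightarrow> jet \<Rightarrow> real" where
  "jet_bracket h r p = frechet h r p - frechet r h p"

definition is_symmetry :: "jet set \<Rightarrow> (jet \<Rightarrow> real) \<Rightarrow> (jet \<Rightarrow> real) \<Rightarrow> bool" where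
  "is_symmetry \<Omega> F G \<longleftrightarrow>
     (\<exists>m. jet_function \<Omega> ({VarX, VarT} \<union> VarU ` {..m}) G) \<and>
     (\<forall>p\<in>\<Omega>. pdiff VarT G p = jet_bracket F G p)"

definition jet_order :: "jet set \<Rightarrow> (jet \<Rightarrow> real) \<Rightarrow> nat" where
  "jet_order \<Omega> G =
     (let I = {i. \<exists>p\<in>\<Omega>. pdiff (VarU i) G p \<noteq> 0} in if I = {} then 0 else Max I)"

text \<open>
  The number \<open>r\<^bsub>k,n,1\<^esub>\<close>; the truncating subtraction of natural numbers in the first branch accounts
  for the maximum with zero.
\<close>

definition r_bound :: "nat \<Rightarrow> nat \<Rightarrow> nat" where
  "r_bound k n =
     (if [k = 0] (mod (n - 1)) \<or> [k = 1] (mod (n - 1)) then k div (n - 1) - 1 else k div (n - 1))"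

end

theory Submission
  imports Defs "HOL-Library.Function_Algebras"
begin

text \<open>
  For a symmetry \<open>G\<close>, differentiating the determining equation shows that the linearizations of \<open>F\<close> and
  \<open>G\<close> commute up to an operator of order at most \<open>max n k\<close>. An operator commuting with the linearization
  \<open>L\<close> of \<open>F\<close> to this accuracy should be a combination of fractional powers of \<open>L\<close>, whose coefficients
  do not depend on \<open>x\<close>. Pseudodifferential operators are avoided as follows. If \<open>a\<close> is the leading
  coefficient of such an operator \<open>C\<close> of order \<open>d\<close> and \<open>f\<close> that of \<open>L\<close>, then \<open>\<kappa> = a\<^sup>n / f\<^sup>d\<close> is annihilated
  by the total derivative, and \<open>C\<^sup>n - \<kappa> L\<^sup>d\<close> is again an almost commuting differential operator, in
  which the distance from the top order to the first \<open>x\<close>-dependent coefficient is smaller by one.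

  Hence the derivative of \<open>G\<close> with respect to \<open>u\<^sub>m\<close> does not depend on \<open>x\<close> for \<open>m \<ge> 2\<close>, \<open>m > k - n + 1\<close>.
  Since the \<open>x\<close>-derivative of a symmetry is a symmetry, repeated differentiation lowers the order by \<open>n - 1\<close> each time until only
  \<open>u\<close> and \<open>u\<^sub>1\<close> remain; the \<open>g\<^sub>j\<close> are then read off the Taylor polynomial of \<open>G\<close> in \<open>x\<close>.
\<close>

section \<open>Differential operators over an algebra of jet functions\<close>

text \<open>
  The algebra \<open>K\<close> is carried by a subset of a ring and has its own unit \<open>e\<close>: for the functions on
  \<open>\<Omega>\<close>, extended by zero to all of jet space, \<open>e\<close> is the indicator function of \<open>\<Omega>\<close>.
\<close>

locale jet_algebra =
  fixes K :: "'a::comm_ring_1 set" and P :: "jet_var \<Rightarrow> 'a \<Rightarrow> 'a" and e :: 'a and u :: "nat \<Rightarrow> 'a"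
  assumes add_K [simp, intro]: "a \<in> K \<Longrightarrow> b \<in> K \<Longrightarrow> a + b \<in> K"
    and uminus_K [simp, intro]: "a \<in> K \<Longrightarrow> - a \<in> K"
    and mult_K [simp, intro]: "a \<in> K \<Longrightarrow> b \<in> K \<Longrightarrow> a * b \<in> K"
    and e_K [simp, intro]: "e \<in> K"
    and u_K [simp, intro]: "u i \<in> K"
    and P_K [simp, intro]: "a \<in> K \<Longrightarrow> P v a \<in> K"
    and e_mult [simp]: "a \<in> K \<Longrightarrow> e * a = a"
    and P_add: "a \<in> K \<Longrightarrow> b \<in> K \<Longrightarrow> P v (a + b) = P v a + P v b"
    and P_mult: "a \<in> K \<Longrightarrow> b \<in> K \<Longrightarrow> P v (a * b) = P v a * b + a * P v b"
    and P_commute: "a \<in> K \<Longrightarrow> P v (P w a) = P w (P v a)"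
    and P_u: "P v (u i) = (if v = VarU i then e else 0)"
    and P_finite: "a \<in> K \<Longrightarrow> \<exists>m. \<forall>i\<ge>m. P (VarU i) a = 0"
    and torsion_free: "a \<in> K \<Longrightarrow> of_nat (Suc n) * a = 0 \<Longrightarrow> a = 0"
    and reduced: "a \<in> K \<Longrightarrow> a * a = 0 \<Longrightarrow> a = 0"
begin

section \<open>Closure of the carrier, powers and nilpotents\<close>

lemma diff_K [simp, intro]: "a \<in> K \<Longrightarrow> b \<in> K \<Longrightarrow> a - b \<in> K"
  using add_K[of a "- b"] by simp

lemma zero_K [simp, intro]: "0 \<in> K"
  using diff_K[of e e] by simp

lemma sum_K [simp, intro]: "(\<And>i. i \<in> I \<Longrightarrow> f i \<in> K) \<Longrightarrow> sum f I \<in> K"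
  by (induction I rule: infinite_finite_induct) auto

lemma of_nat_mult_K [simp, intro]: "a \<in> K \<Longrightarrow> of_nat n * a \<in> K"
  by (induction n) (auto simp: algebra_simps)

lemma mult_power_K [simp, intro]: "a \<in> K \<Longrightarrow> b \<in> K \<Longrightarrow> a * b ^ n \<in> K"
  by (induction n) (auto simp: mult.left_commute[of a b])

text \<open>The exponent 0 is excluded because it gives the unit of the ambient ring, which may lie
  outside \<open>K\<close>; the unit of \<open>K\<close> is \<open>e\<close>.\<close>

lemma power_K: "a \<in> K \<Longrightarrow> n \<ge> 1 \<Longrightarrow> a ^ n \<in> K"
  by (cases n) auto

text \<open>Halving of the exponent: for \<open>m\<close> equal to half of \<open>n\<close> rounded
  up, the square of \<open>a ^ m\<close> vanishes, so \<open>reduced\<close> replaces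
  \<open>n\<close> by the smaller \<open>m\<close>.\<close>

lemma nilpotent_zero: "a \<in> K \<Longrightarrow> a ^ n = 0 \<Longrightarrow> a = 0"
proof (induction n arbitrary: a rule: less_induct)
  case (less n)
  show ?case
  proof (cases "n \<le> 1")
    case True
    then consider "n = 0" | "n = 1" by linarith
    then show ?thesis
    proof cases
      \<comment> \<open>Here \<open>a ^ 0 = 1\<close>, so the whole ring is trivial.\<close>
      case 1
      then have "(1::'a) = 0" using less.prems by simp
      then show ?thesis by (metis mult_1 mult_zero_left)
    next
      case 2
      then show ?thesis using less.prems by simp
    qed
  next
    case False
    define m where "m = (n + 1) div 2"
    have m: "m < n" "m \<ge> 1" "n \<le> m + m" using False by (auto simp: m_def)
    then have "a ^ (m + m) = 0"
      using less.prems(2) by (metis le_add_diff_inverse mult_zero_left power_add)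
    then have "a ^ m = 0"
      using reduced[of "a ^ m"] power_K[OF less.prems(1) m(2)] by (simp add: power_add)
    then show ?thesis using less.IH[OF m(1) less.prems(1)] by simp
  qed
qed

section \<open>Partial derivatives and bounds on the coordinates involved\<close>

lemma P_zero [simp]: "P v 0 = 0"
  using P_add[of 0 0 v] by simp

lemma P_uminus: "a \<in> K \<Longrightarrow> P v (- a) = - P v a"
  using P_add[of a "- a" v] by (simp add: eq_neg_iff_add_eq_0 add.commute)

lemma P_diff: "a \<in> K \<Longrightarrow> b \<in> K \<Longrightarrow> P v (a - b) = P v a - P v b"
  using P_add[of a "- b" v] by (simp add: P_uminus)

lemma P_sum: "(\<And>i. i \<in> I \<Longrightarrow> f i \<in> K) \<Longrightarrow> P v (sum f I) = (\<Sum>i\<in>I. P v (f i))"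
  by (induction I rule: infinite_finite_induct) (auto simp: P_add)

lemma P_e [simp]: "P v e = 0"
  using P_mult[of e e v] by (simp add: mult.commute)

text \<open>The bound is exclusive: order at most k is \<open>ubound (Suc k)\<close>. It need not be
  sharp, so finitely many elements always share one.\<close>

definition ubound :: "nat \<Rightarrow> 'a \<Rightarrow> bool" where
  "ubound m a \<longleftrightarrow> (\<forall>i\<ge>m. P (VarU i) a = 0)"

lemma uboundD: "ubound m a \<Longrightarrow> i \<ge> m \<Longrightarrow> P (VarU i) a = 0"
  by (simp add: ubound_def)

lemma ubound_mono: "ubound m a \<Longrightarrow> m \<le> n \<Longrightarrow> ubound n a"
  by (simp add: ubound_def)

lemma ex_ubound: "a \<in> K \<Longrightarrow> \<exists>m. ubound m a"
  using P_finite by (simp add: ubound_def)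

lemma ex_ubound_finite: "finite I \<Longrightarrow> (\<And>i. i \<in> I \<Longrightarrow> f i \<in> K) \<Longrightarrow> \<exists>m. \<forall>i\<in>I. ubound m (f i)"
proof (induction I rule: finite_induct)
  case (insert x I)
  then obtain m where m: "\<forall>i\<in>I. ubound m (f i)" by auto
  obtain l where "ubound l (f x)" using ex_ubound insert.prems by blast
  then show ?case using m by (intro exI[of _ "max l m"]) (auto intro: ubound_mono)
qed auto

lemma ubound_P: "a \<in> K \<Longrightarrow> ubound m a \<Longrightarrow> ubound m (P v a)"
  unfolding ubound_def by (metis P_commute P_zero)

lemma ubound_add: "a \<in> K \<Longrightarrow> b \<in> K \<Longrightarrow> ubound m a \<Longrightarrow> ubound m b \<Longrightarrow> ubound m (a + b)"
  by (simp add: ubound_def P_add)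

lemma ubound_mult: "a \<in> K \<Longrightarrow> b \<in> K \<Longrightarrow> ubound m a \<Longrightarrow> ubound m b \<Longrightarrow> ubound m (a * b)"
  by (simp add: ubound_def P_mult)

section \<open>The total derivative and its kernel\<close>

text \<open>Summation over the support, which is finite on \<open>K\<close> by
  \<open>P_finite\<close>, avoids the choice of a bound; \<open>D_eq\<close> allows any range that
  contains the support.\<close>

definition D :: "'a \<Rightarrow> 'a" where
  "D a = P VarX a + (\<Sum>i | P (VarU i) a \<noteq> 0. u (Suc i) * P (VarU i) a)"

lemma D_eq:
  assumes "ubound m a"
  shows "D a = P VarX a + (\<Sum>i<m. u (Suc i) * P (VarU i) a)"
  unfolding D_def using assms
  by (intro arg_cong2[of _ _ _ _ "(+)"] refl sum.mono_neutral_left)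
     (auto simp: ubound_def not_less[symmetric])

lemma D_K [simp, intro]: "a \<in> K \<Longrightarrow> D a \<in> K"
  unfolding D_def by auto

lemma D_add: assumes "a \<in> K" "b \<in> K" shows "D (a + b) = D a + D b"
proof -
  obtain l m where "ubound l a" "ubound m b" using assms ex_ubound by meson
  then have *: "ubound (max l m) a" "ubound (max l m) b" by (auto intro: ubound_mono)
  show ?thesis
    using D_eq[OF *(1)] D_eq[OF *(2)] D_eq[OF ubound_add[OF assms *]]
    by (simp add: P_add assms sum.distrib algebra_simps)
qed

lemma D_mult: assumes "a \<in> K" "b \<in> K" shows "D (a * b) = D a * b + a * D b"
proof -
  obtain l m where "ubound l a" "ubound m b" using assms ex_ubound by meson
  then have *: "ubound (max l m) a" "ubound (max l m) b" by (auto intro: ubound_mono)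
  show ?thesis
    using D_eq[OF *(1)] D_eq[OF *(2)] D_eq[OF ubound_mult[OF assms *]]
    by (simp add: P_mult assms sum.distrib algebra_simps sum_distrib_left sum_distrib_right)
qed

lemma D_zero [simp]: "D 0 = 0"
  using D_add[of 0 0] by simp

lemma D_uminus: "a \<in> K \<Longrightarrow> D (- a) = - D a"
  using D_add[of a "- a"] by (simp add: eq_neg_iff_add_eq_0 add.commute)

lemma D_diff: "a \<in> K \<Longrightarrow> b \<in> K \<Longrightarrow> D (a - b) = D a - D b"
  using D_add[of a "- b"] by (simp add: D_uminus)

lemma D_sum: "(\<And>i. i \<in> I \<Longrightarrow> f i \<in> K) \<Longrightarrow> D (sum f I) = (\<Sum>i\<in>I. D (f i))"
  by (induction I rule: infinite_finite_induct) (auto simp: D_add)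

lemma D_of_nat_mult: "a \<in> K \<Longrightarrow> D (of_nat n * a) = of_nat n * D a"
  by (induction n) (auto simp: distrib_right D_add)

lemma D_e: "D e = 0"
  using D_eq[of 0 e] by (simp add: ubound_def)

lemma D_u: "D (u i) = u (Suc i)"
proof -
  have "ubound (Suc i) (u i)" by (simp add: ubound_def P_u)
  then have "D (u i) = (\<Sum>j<Suc i. u (Suc j) * (if j = i then e else 0))"
    by (subst D_eq) (auto simp: P_u intro!: sum.cong)
  also have "\<dots> = u (Suc i)" by (simp add: mult.commute[of _ e])
  finally show ?thesis .
qed

lemma Dn_K [simp, intro]: "a \<in> K \<Longrightarrow> (D ^^ i) a \<in> K"
  by (induction i) auto

lemma Dn_zero [simp]: "(D ^^ i) 0 = 0"
  by (induction i) auto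

lemma Dn_add: "a \<in> K \<Longrightarrow> b \<in> K \<Longrightarrow> (D ^^ i) (a + b) = (D ^^ i) a + (D ^^ i) b"
  by (induction i) (auto simp: D_add)

lemma Dn_sum: "(\<And>i. i \<in> I \<Longrightarrow> f i \<in> K) \<Longrightarrow> (D ^^ n) (sum f I) = (\<Sum>i\<in>I. (D ^^ n) (f i))"
  by (induction I rule: infinite_finite_induct) (auto simp: Dn_add)

lemma Dn_u: "(D ^^ i) (u j) = u (i + j)"
  by (induction i) (auto simp: D_u)

text \<open>All partial derivatives commute with each other, so the only defect comes from the
  coefficient \<open>u (Suc i)\<close> in \<open>D\<close>, whose derivative by that same coordinate
  is \<open>e\<close>.\<close>

lemma P_D:
  assumes "a \<in> K"
  shows "P v (D a) = D (P v a) + (case v of VarU (Suc i) \<Rightarrow> P (VarU i) a | _ \<Rightarrow> 0)"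
proof -
  obtain m0 where m0: "ubound m0 a" using ex_ubound assms by blast
  \<comment> \<open>The range must also contain the index of the extra term, even if
    \<open>a\<close> does not involve that coordinate.\<close>
  define m where "m = max m0 (case v of VarU (Suc i) \<Rightarrow> Suc i | _ \<Rightarrow> 0)"
  have m: "ubound m a" using m0 by (auto simp: m_def intro: ubound_mono)
  have "P v (D a) = P v (P VarX a) +
      (\<Sum>i<m. P v (u (Suc i)) * P (VarU i) a + u (Suc i) * P v (P (VarU i) a))"
    unfolding D_eq[OF m] using assms by (simp add: P_add P_sum P_mult)
  also have "\<dots> = P VarX (P v a) + (\<Sum>i<m. u (Suc i) * P (VarU i) (P v a)) +
      (\<Sum>i<m. if v = VarU (Suc i) then P (VarU i) a else 0)"
    using assms by (auto simp: sum.distrib P_commute[of a v] P_u intro!: sum.cong)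
  also have "(\<Sum>i<m. if v = VarU (Suc i) then P (VarU i) a else 0) =
      (case v of VarU (Suc i) \<Rightarrow> P (VarU i) a | _ \<Rightarrow> 0)"
    by (auto split: jet_var.split nat.split simp: m_def)
  also have "P VarX (P v a) + (\<Sum>i<m. u (Suc i) * P (VarU i) (P v a)) = D (P v a)"
    using D_eq[OF ubound_P[OF assms m]] by simp
  finally show ?thesis .
qed

lemma PX_D: "a \<in> K \<Longrightarrow> P VarX (D a) = D (P VarX a)"
  by (simp add: P_D)

lemma PX_Dn: "a \<in> K \<Longrightarrow> P VarX ((D ^^ i) a) = (D ^^ i) (P VarX a)"
  by (induction i) (auto simp: PX_D)

text \<open>If \<open>u m\<close> is the highest coordinate that may occur in \<open>a\<close>, then
  by \<open>P_D\<close> the derivative of \<open>D a\<close> by \<open>u (Suc m)\<close> is that of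
  \<open>a\<close> by \<open>u m\<close>. So this vanishes, and descending on \<open>m\<close>
  removes every \<open>u i\<close>; \<open>D a\<close> is then just the x-derivative.\<close>

lemma D_zero_imp_P_zero:
  assumes a: "a \<in> K" and "D a = 0"
  shows "ubound 0 a" "P VarX a = 0"
proof -
  obtain m where "ubound m a" using ex_ubound a by blast
  then show 0: "ubound 0 a"
  proof (induction m)
    case (Suc m)
    have "P (VarU m) a = P (VarU (Suc m)) (D a) - D (P (VarU (Suc m)) a)"
      using P_D[OF a, of "VarU (Suc m)"] by simp
    also have "\<dots> = 0" using uboundD[OF Suc.prems, of "Suc m"] assms by simp
    finally have "P (VarU m) a = 0" .
    then have "ubound m a" using Suc.prems
      by (auto simp: ubound_def) (metis le_antisym not_less_eq_eq)
    then show ?case by (rule Suc.IH)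
  qed
  show "P VarX a = 0" using D_eq[OF 0] assms by simp
qed

section \<open>Differential operators filtered by order\<close>

text \<open>\<open>Op N\<close> holds the operators of order strictly below \<open>N\<close>, so
  \<open>Op 0\<close> consists of those that vanish on \<open>K\<close>. Only values on
  \<open>K\<close> count: maps that agree there represent the same operator.\<close>

definition Op :: "nat \<Rightarrow> ('a \<Rightarrow> 'a) set" where
  "Op N = {T. \<exists>c. (\<forall>i. c i \<in> K) \<and> (\<forall>r\<in>K. T r = (\<Sum>i<N. c i * (D ^^ i) r))}"

lemma OpI: "(\<And>i. c i \<in> K) \<Longrightarrow> (\<And>r. r \<in> K \<Longrightarrow> T r = (\<Sum>i<N. c i * (D ^^ i) r)) \<Longrightarrow> T \<in> Op N"
  unfolding Op_def by blast

lemma OpE: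
  assumes "T \<in> Op N"
  obtains c where "\<And>i. c i \<in> K" "\<And>r. r \<in> K \<Longrightarrow> T r = (\<Sum>i<N. c i * (D ^^ i) r)"
  using assms unfolding Op_def by blast

lemma Op_cong: "T \<in> Op N \<Longrightarrow> (\<And>r. r \<in> K \<Longrightarrow> S r = T r) \<Longrightarrow> S \<in> Op N"
  unfolding Op_def by auto

lemma Op_K: "T \<in> Op N \<Longrightarrow> r \<in> K \<Longrightarrow> T r \<in> K"
  by (elim OpE) auto

lemma Op_mono:
  assumes "T \<in> Op N" "N \<le> M" shows "T \<in> Op M"
proof -
  obtain c where c: "\<And>i. c i \<in> K" "\<And>r. r \<in> K \<Longrightarrow> T r = (\<Sum>i<N. c i * (D ^^ i) r)"
    using OpE[OF assms(1)] by blast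
  show ?thesis
  proof (rule OpI[of "\<lambda>i. if i < N then c i else 0"])
    fix r assume "r \<in> K"
    then show "T r = (\<Sum>i<M. (if i < N then c i else 0) * (D ^^ i) r)"
      unfolding c(2)[OF \<open>r \<in> K\<close>] using assms(2) by (intro sum.mono_neutral_cong_left) auto
  qed (use c in auto)
qed

lemma Op_zero [simp]: "(\<lambda>r. 0) \<in> Op N"
  by (rule OpI[of "\<lambda>_. 0"]) auto

lemma Op_add: "T \<in> Op N \<Longrightarrow> S \<in> Op N \<Longrightarrow> (\<lambda>r. T r + S r) \<in> Op N"
proof (elim OpE)
  fix c d assume "\<And>i. c i \<in> K" "\<And>i. d i \<in> K"
    "\<And>r. r \<in> K \<Longrightarrow> T r = (\<Sum>i<N. c i * (D ^^ i) r)" "\<And>r. r \<in> K \<Longrightarrow> S r = (\<Sum>i<N. d i * (D ^^ i) r)"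
  then show ?thesis
    by (intro OpI[of "\<lambda>i. c i + d i"]) (auto simp: sum.distrib algebra_simps)
qed

lemma Op_lmult: "a \<in> K \<Longrightarrow> T \<in> Op N \<Longrightarrow> (\<lambda>r. a * T r) \<in> Op N"
proof (elim OpE)
  fix c assume "a \<in> K" "\<And>i. c i \<in> K" "\<And>r. r \<in> K \<Longrightarrow> T r = (\<Sum>i<N. c i * (D ^^ i) r)"
  then show ?thesis
    by (intro OpI[of "\<lambda>i. a * c i"]) (auto simp: sum_distrib_left mult.assoc)
qed

lemma Op_uminus: "T \<in> Op N \<Longrightarrow> (\<lambda>r. - T r) \<in> Op N"
  by (rule Op_cong[OF Op_lmult[of "- e"]]) (auto simp: Op_K)

lemma Op_diff: "T \<in> Op N \<Longrightarrow> S \<in> Op N \<Longrightarrow> (\<lambda>r. T r - S r) \<in> Op N"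
  using Op_add[of T N "\<lambda>r. - S r"] Op_uminus[of S N] by simp

lemma Op_sum: "(\<And>i. i \<in> I \<Longrightarrow> T i \<in> Op N) \<Longrightarrow> (\<lambda>r. \<Sum>i\<in>I. T i r) \<in> Op N"
  by (induction I rule: infinite_finite_induct) (auto intro!: Op_add)

lemma Op_monomial: "a \<in> K \<Longrightarrow> i < N \<Longrightarrow> (\<lambda>r. a * (D ^^ i) r) \<in> Op N"
  by (rule OpI[of "\<lambda>j. if j = i then a else 0"]) (auto simp: if_distrib[of "\<lambda>x. x * _"] cong: if_cong)

lemma Op_additive: "T \<in> Op N \<Longrightarrow> r \<in> K \<Longrightarrow> s \<in> K \<Longrightarrow> T (r + s) = T r + T s"
  by (elim OpE) (auto simp: Dn_add sum.distrib algebra_simps)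

lemma Op_diff_arg: "T \<in> Op N \<Longrightarrow> r \<in> K \<Longrightarrow> s \<in> K \<Longrightarrow> T (r - s) = T r - T s"
  using Op_additive[of T N "r - s" s] by simp

lemma Op_rD:
  assumes "T \<in> Op N" shows "(\<lambda>r. T ((D ^^ j) r)) \<in> Op (N + j)"
proof -
  obtain c where c: "\<And>i. c i \<in> K" "\<And>r. r \<in> K \<Longrightarrow> T r = (\<Sum>i<N. c i * (D ^^ i) r)"
    using OpE[OF assms] by blast
  have "(\<lambda>r. \<Sum>i<N. c i * (D ^^ (i + j)) r) \<in> Op (N + j)"
    using c by (intro Op_sum Op_monomial) auto
  then show ?thesis by (rule Op_cong) (use c in \<open>auto simp: funpow_add\<close>)
qed

lemma Op_D:
  assumes "T \<in> Op N" shows "(\<lambda>r. D (T r)) \<in> Op (Suc N)"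
proof -
  obtain c where c: "\<And>i. c i \<in> K" "\<And>r. r \<in> K \<Longrightarrow> T r = (\<Sum>i<N. c i * (D ^^ i) r)"
    using OpE[OF assms] by blast
  have "(\<lambda>r. \<Sum>i<N. D (c i) * (D ^^ i) r + c i * (D ^^ (Suc i)) r) \<in> Op (Suc N)"
    using c by (intro Op_sum Op_add Op_monomial) auto
  then show ?thesis
    by (rule Op_cong) (use c in \<open>auto simp: D_sum D_mult\<close>)
qed

lemma Op_Dn: "T \<in> Op N \<Longrightarrow> (\<lambda>r. (D ^^ i) (T r)) \<in> Op (N + i)"
  by (induction i) (auto dest: Op_D)

lemma Op_comp:
  assumes "T \<in> Op N" "S \<in> Op M" shows "(\<lambda>r. T (S r)) \<in> Op (N + M - 1)"
proof -
  obtain c where c: "\<And>i. c i \<in> K" "\<And>r. r \<in> K \<Longrightarrow> T r = (\<Sum>i<N. c i * (D ^^ i) r)"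
    using OpE[OF assms(1)] by blast
  have "(\<lambda>r. \<Sum>i<N. c i * (D ^^ i) (S r)) \<in> Op (N + M - 1)"
  proof (intro Op_sum Op_lmult)
    fix i assume "i \<in> {..<N}"
    then show "(\<lambda>r. (D ^^ i) (S r)) \<in> Op (N + M - 1)"
      by (intro Op_mono[OF Op_Dn[OF assms(2)]]) auto
  qed (use c in auto)
  then show ?thesis by (rule Op_cong) (use c assms Op_K in auto)
qed

section \<open>Leading coefficients\<close>

text \<open>The coefficient \<open>a\<close> may be zero, so \<open>d\<close> only bounds the order
  from above; \<open>lead T d 0\<close> says that the order is below \<open>d\<close>.\<close>

definition lead :: "('a \<Rightarrow> 'a) \<Rightarrow> nat \<Rightarrow> 'a \<Rightarrow> bool" where
  "lead T d a \<longleftrightarrow> a \<in> K \<and> (\<lambda>r. T r - a * (D ^^ d) r) \<in> Op d"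

lemma lead_K: "lead T d a \<Longrightarrow> a \<in> K"
  by (simp add: lead_def)

lemma lead_Op: "lead T d a \<Longrightarrow> T \<in> Op (Suc d)"
  unfolding lead_def
  using Op_cong[OF Op_add[OF Op_monomial[of a d "Suc d"] Op_mono[of "\<lambda>r. T r - a * (D ^^ d) r" d "Suc d"]], of T]
  by auto

lemma leadE:
  assumes "lead T d a"
  obtains S where "S \<in> Op d" "\<And>r. T r = a * (D ^^ d) r + S r"
  using assms unfolding lead_def by force

lemma leadI: "a \<in> K \<Longrightarrow> S \<in> Op d \<Longrightarrow> (\<And>r. r \<in> K \<Longrightarrow> T r = a * (D ^^ d) r + S r) \<Longrightarrow> lead T d a"
  unfolding lead_def by (auto intro: Op_cong)

lemma lead_cong: "lead T d a \<Longrightarrow> (\<And>r. r \<in> K \<Longrightarrow> S r = T r) \<Longrightarrow> lead S d a"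
  unfolding lead_def by (auto intro: Op_cong)

lemma ex_lead: assumes "T \<in> Op (Suc d)" obtains a where "lead T d a"
proof -
  obtain c where c: "\<And>i. c i \<in> K" "\<And>r. r \<in> K \<Longrightarrow> T r = (\<Sum>i<Suc d. c i * (D ^^ i) r)"
    using OpE[OF assms] by blast
  have "lead T d (c d)"
    by (rule leadI[of _ "\<lambda>r. \<Sum>i<d. c i * (D ^^ i) r"]) (use c in \<open>auto intro: OpI[of c]\<close>)
  then show ?thesis by (rule that)
qed

lemma lead_zero: "T \<in> Op d \<Longrightarrow> lead T d 0"
  by (simp add: lead_def)

lemma lead_zero_Op: "lead T d 0 \<Longrightarrow> T \<in> Op d"
  by (simp add: lead_def)

lemma lead_add: "lead T d a \<Longrightarrow> lead S d b \<Longrightarrow> lead (\<lambda>r. T r + S r) d (a + b)"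
  unfolding lead_def by (auto intro: Op_cong[OF Op_add] simp: algebra_simps)

lemma lead_lmult: "b \<in> K \<Longrightarrow> lead T d a \<Longrightarrow> lead (\<lambda>r. b * T r) d (b * a)"
  unfolding lead_def by (auto intro: Op_cong[OF Op_lmult[of b]] simp: algebra_simps)

lemma lead_diff: "lead T d a \<Longrightarrow> lead S d b \<Longrightarrow> lead (\<lambda>r. T r - S r) d (a - b)"
  unfolding lead_def by (auto intro: Op_cong[OF Op_diff] simp: algebra_simps)

text \<open>Test the operator on a coordinate \<open>u M\<close> beyond all those occurring in the
  coefficients. Then \<open>(D ^^ i) (u M)\<close> is \<open>u (i + M)\<close>, and differentiation
  by this coordinate isolates the coefficient \<open>c i\<close>.\<close>

lemma coeffs_unique:
  assumes c: "\<And>i. c i \<in> K" and 0: "\<And>r. r \<in> K \<Longrightarrow> (\<Sum>i<N. c i * (D ^^ i) r) = 0" and "i < N"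
  shows "c i = 0"
proof -
  obtain M where M: "\<forall>i\<in>{..<N}. ubound M (c i)" using ex_ubound_finite[of "{..<N}" c] c by auto
  have "0 = P (VarU (i + M)) (\<Sum>j<N. c j * u (j + M))"
    using 0[of "u M"] by (simp add: Dn_u)
  also have "\<dots> = (\<Sum>j<N. c j * (if j = i then e else 0))"
    using M c by (auto simp: P_sum P_mult P_u ubound_def intro!: sum.cong)
  also have "\<dots> = c i" using \<open>i < N\<close> c
    by (simp add: if_distrib[of "(*) _"] mult.commute[of _ e] cong: if_cong)
  finally show ?thesis by simp
qed

text \<open>This converts bounds on the order of an operator into equations between functions, which
  is how every differential equation for a leading coefficient arises below.\<close>

lemma lead_eq_zero:
  assumes "lead T d a" "T \<in> Op d" shows "a = 0"
proof -
  have "(\<lambda>r. a * (D ^^ d) r) \<in> Op d"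
    using Op_diff[OF assms(2), of "\<lambda>r. T r - a * (D ^^ d) r"] assms(1) by (simp add: lead_def)
  then obtain c where c: "\<And>i. c i \<in> K" "\<And>r. r \<in> K \<Longrightarrow> a * (D ^^ d) r = (\<Sum>i<d. c i * (D ^^ i) r)"
    using OpE by blast
  have "(if d = d then - a else c d) = 0"
    by (rule coeffs_unique[where N = "Suc d" and c = "\<lambda>i. if i = d then - a else c i"])
       (use c lead_K[OF assms(1)] in auto)
  then show ?thesis by simp
qed

lemma lead_unique: assumes "lead T d a" "lead T d b" shows "a = b"
  using lead_eq_zero[OF lead_diff[OF assms]] by simp

lemma lead_D: assumes "lead T d a" shows "lead (\<lambda>r. D (T r)) (Suc d) a"
proof -
  obtain S where S: "S \<in> Op d" "\<And>r. T r = a * (D ^^ d) r + S r" using leadE[OF assms] by blast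
  have "(\<lambda>r. D a * (D ^^ d) r + D (S r)) \<in> Op (Suc d)"
    using S assms by (intro Op_add Op_monomial Op_D) (auto dest: lead_K)
  then show ?thesis
    by (rule leadI[rotated]) (use S lead_K[OF assms] Op_K in \<open>auto simp: D_add D_mult\<close>)
qed

lemma lead_Dn: "lead T d a \<Longrightarrow> lead (\<lambda>r. (D ^^ i) (T r)) (d + i) a"
  by (induction i) (auto dest: lead_D)

lemma lead_comp:
  assumes T: "lead T d a" and S: "lead S m b" shows "lead (\<lambda>r. T (S r)) (d + m) (a * b)"
proof -
  obtain T' where T': "T' \<in> Op d" "\<And>r. T r = a * (D ^^ d) r + T' r" using leadE[OF T] by blast
  have "(\<lambda>r. T' (S r)) \<in> Op (d + m)" using Op_comp[OF T'(1) lead_Op[OF S]] by simp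
  moreover have "lead (\<lambda>r. a * (D ^^ d) (S r)) (d + m) (a * b)"
    using lead_lmult[OF lead_K[OF T] lead_Dn[OF S, of d]] by (simp add: add.commute)
  ultimately have "lead (\<lambda>r. a * (D ^^ d) (S r) + T' (S r)) (d + m) (a * b + 0)"
    by (intro lead_add lead_zero)
  then show ?thesis using T' by simp
qed

section \<open>Leibniz expansion and commutators\<close>

text \<open>The Leibniz formula up to its two highest terms. For \<open>i = 0\<close> the truncated
  exponent \<open>i - 1\<close> is harmless because its coefficient is 0.\<close>

lemma Dn_mult:
  assumes b: "b \<in> K"
  shows "(\<lambda>r. (D ^^ i) (b * r) - b * (D ^^ i) r - of_nat i * D b * (D ^^ (i - 1)) r) \<in> Op (i - 1)"
proof (induction i)
  case 0
  then show ?case using Op_zero by simp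
next
  case (Suc i)
  let ?E = "\<lambda>r. (D ^^ i) (b * r) - b * (D ^^ i) r - of_nat i * D b * (D ^^ (i - 1)) r"
  show ?case
  proof (cases "i = 0")
    \<comment> \<open>Treated apart: applying \<open>D\<close> to the induction hypothesis would
      only give a remainder in \<open>Op 1\<close>, while \<open>Op 0\<close> is required.\<close>
    case True
    show ?thesis unfolding True by (rule Op_cong[OF Op_zero]) (auto simp: D_mult b)
  next
    case False
    then obtain j where j: "i = Suc j" by (cases i) auto
    have E: "(\<lambda>r. D (?E r)) \<in> Op i" using Op_D[OF Suc.IH] False by simp
    have *: "(\<lambda>r. D (?E r) + of_nat i * D (D b) * (D ^^ (i - 1)) r) \<in> Op (Suc i - 1)"
      unfolding diff_Suc_1
      by (intro Op_add E Op_monomial) (use b False in \<open>auto simp: mult.assoc\<close>)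
    show ?thesis
    proof (rule Op_cong[OF *])
      fix r assume r: "r \<in> K"
      have "D (?E r) = D ((D ^^ i) (b * r)) - (D b * (D ^^ i) r + b * D ((D ^^ i) r))
          - of_nat i * (D (D b) * (D ^^ (i - 1)) r + D b * D ((D ^^ (i - 1)) r))"
        using b r by (simp add: D_diff D_mult mult.assoc D_of_nat_mult)
      moreover have "D ((D ^^ (i - 1)) r) = (D ^^ i) r" by (simp add: j)
      ultimately show "(D ^^ Suc i) (b * r) - b * (D ^^ Suc i) r - of_nat (Suc i) * D b * (D ^^ (Suc i - 1)) r =
          D (?E r) + of_nat i * D (D b) * (D ^^ (i - 1)) r"
        by (simp add: algebra_simps)
    qed
  qed
qed

lemma monomial_comp:
  assumes "a \<in> K" "b \<in> K"
  shows "(\<lambda>r. a * (D ^^ i) (b * (D ^^ j) r) - (a * b * (D ^^ (i + j)) r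
            + of_nat i * (a * D b) * (D ^^ (i + j - 1)) r)) \<in> Op (i + j - 1)"
proof (cases "i = 0")
  case True
  show ?thesis unfolding True by (rule Op_cong[OF Op_zero]) (auto simp: mult.assoc)
next
  case False
  have "(\<lambda>r. a * ((D ^^ i) (b * (D ^^ j) r) - b * (D ^^ i) ((D ^^ j) r)
      - of_nat i * D b * (D ^^ (i - 1)) ((D ^^ j) r))) \<in> Op (i - 1 + j)"
    using Op_lmult[OF assms(1) Op_rD[OF Dn_mult[OF assms(2), of i], of j]] by simp
  moreover have "(D ^^ (i - 1)) ((D ^^ j) r) = (D ^^ (i + j - 1)) r" for r
    using False by (simp flip: funpow_add[THEN fun_cong, simplified o_apply])
  ultimately show ?thesis using False
    by (simp add: funpow_add algebra_simps)
qed

definition comm :: "('a \<Rightarrow> 'a) \<Rightarrow> ('a \<Rightarrow> 'a) \<Rightarrow> 'a \<Rightarrow> 'a" where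
  "comm T S r = T (S r) - S (T r)"

text \<open>The terms with \<open>a * b\<close> cancel since the functions commute, so the order
  drops by one and the second terms of the Leibniz expansions become leading.\<close>

lemma comm_monomial:
  assumes "a \<in> K" "b \<in> K"
  shows "(\<lambda>r. comm (\<lambda>r. a * (D ^^ i) r) (\<lambda>r. b * (D ^^ j) r) r
           - (of_nat i * (a * D b) - of_nat j * (b * D a)) * (D ^^ (i + j - 1)) r) \<in> Op (i + j - 1)"
  using Op_diff[OF monomial_comp[OF assms, of i j] monomial_comp[OF assms(2,1), of j i, unfolded add.commute[of j i]]]
  by (simp add: comm_def algebra_simps)

lemma comm_monomial_Op:
  assumes "a \<in> K" "b \<in> K"
  shows "comm (\<lambda>r. a * (D ^^ i) r) (\<lambda>r. b * (D ^^ j) r) \<in> Op (i + j)"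
proof (cases "i + j = 0")
  case True
  then have "i = 0" "j = 0" by auto
  show ?thesis unfolding \<open>i = 0\<close> \<open>j = 0\<close>
    by (rule Op_cong[OF Op_zero]) (auto simp: comm_def)
next
  case False
  have "(of_nat i * (a * D b) - of_nat j * (b * D a)) \<in> K" using assms by auto
  then have "lead (comm (\<lambda>r. a * (D ^^ i) r) (\<lambda>r. b * (D ^^ j) r)) (i + j - 1)
         (of_nat i * (a * D b) - of_nat j * (b * D a))"
    using comm_monomial[OF assms, of i j] unfolding lead_def by auto
  then show ?thesis using lead_Op False by fastforce
qed

lemma comm_Op:
  assumes "T \<in> Op N" "S \<in> Op M" shows "comm T S \<in> Op (N + M - 2)"
proof -
  obtain c where c: "\<And>i. c i \<in> K" "\<And>r. r \<in> K \<Longrightarrow> T r = (\<Sum>i<N. c i * (D ^^ i) r)"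
    using OpE[OF assms(1)] by blast
  obtain d where d: "\<And>i. d i \<in> K" "\<And>r. r \<in> K \<Longrightarrow> S r = (\<Sum>i<M. d i * (D ^^ i) r)"
    using OpE[OF assms(2)] by blast
  have "(\<lambda>r. \<Sum>i<N. \<Sum>j<M. comm (\<lambda>r. c i * (D ^^ i) r) (\<lambda>r. d j * (D ^^ j) r) r) \<in> Op (N + M - 2)"
    using c d by (intro Op_sum Op_mono[OF comm_monomial_Op]) auto
  then show ?thesis
  proof (rule Op_cong)
    fix r assume r: "r \<in> K"
    have "T (S r) = (\<Sum>i<N. \<Sum>j<M. c i * (D ^^ i) (d j * (D ^^ j) r))"
      using c d r by (simp add: Dn_sum sum_distrib_left)
    moreover have "S (T r) = (\<Sum>i<N. \<Sum>j<M. d j * (D ^^ j) (c i * (D ^^ i) r))"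
      using c d r by (subst sum.swap) (simp add: Dn_sum sum_distrib_left)
    ultimately show "comm T S r =
        (\<Sum>i<N. \<Sum>j<M. comm (\<lambda>r. c i * (D ^^ i) r) (\<lambda>r. d j * (D ^^ j) r) r)"
      by (simp add: comm_def sum_subtractf)
  qed
qed

text \<open>Only the two leading monomials contribute: a commutator that involves a lower part has
  order below \<open>d + m - 1\<close>. If the commutator itself has smaller order, this gives a
  first-order equation relating \<open>a\<close> and \<open>b\<close>.\<close>

lemma lead_comm:
  assumes T: "lead T d a" and S: "lead S m b" and "d + m \<ge> 1"
  shows "lead (comm T S) (d + m - 1) (of_nat d * (a * D b) - of_nat m * (b * D a))"
proof -
  obtain T' where T': "T' \<in> Op d" "\<And>r. T r = a * (D ^^ d) r + T' r" using leadE[OF T] by blast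
  obtain S' where S': "S' \<in> Op m" "\<And>r. S r = b * (D ^^ m) r + S' r" using leadE[OF S] by blast
  have K: "a \<in> K" "b \<in> K" using T S by (auto dest: lead_K)
  let ?A = "\<lambda>r. a * (D ^^ d) r" and ?B = "\<lambda>r. b * (D ^^ m) r"
  have A: "?A \<in> Op (Suc d)" using K by (intro Op_monomial) auto
  have 1: "comm ?A S' \<in> Op (d + m - 1)" using comm_Op[OF A S'(1)] by simp
  have 2: "comm T' S \<in> Op (d + m - 1)" using comm_Op[OF T'(1) lead_Op[OF S]] by simp
  have 3: "lead (comm ?A ?B) (d + m - 1) (of_nat d * (a * D b) - of_nat m * (b * D a))"
    using comm_monomial[OF K, of d m] K unfolding lead_def by auto
  have "lead (\<lambda>r. comm ?A ?B r + (comm ?A S' r + comm T' S r)) (d + m - 1)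
     ((of_nat d * (a * D b) - of_nat m * (b * D a)) + 0)"
    by (intro lead_add 3 lead_zero Op_add 1 2)
  then have *: "lead (\<lambda>r. comm ?A ?B r + (comm ?A S' r + comm T' S r)) (d + m - 1)
     (of_nat d * (a * D b) - of_nat m * (b * D a))" by simp
  show ?thesis
  proof (rule lead_cong[OF *])
    fix r assume r: "r \<in> K"
    have "T (S r) = ?A (?B r) + ?A (S' r) + T' (S r)"
      using K r Op_K[OF S'(1) r] unfolding T'(2) S'(2)[of r] by (simp add: Dn_add algebra_simps)
    moreover have "S (T r) = ?B (?A r) + S' (?A r) + S (T' r)"
      unfolding T'(2)[of r] Op_additive[OF lead_Op[OF S] Op_K[OF A r] Op_K[OF T'(1) r]]
      by (simp add: S'(2))
    ultimately show "comm T S r = comm ?A ?B r + (comm ?A S' r + comm T' S r)"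
      by (simp add: comm_def)
  qed
qed

section \<open>Explicit x-dependence of the coefficients\<close>

text \<open>Since \<open>P VarX\<close> commutes with \<open>D\<close>, this commutator just
  differentiates each coefficient by x; its order locates the highest coefficient that depends on
  x.\<close>

lemma comm_PX_Op: assumes "T \<in> Op N" shows "comm (P VarX) T \<in> Op N"
proof -
  obtain c where c: "\<And>i. c i \<in> K" "\<And>r. r \<in> K \<Longrightarrow> T r = (\<Sum>i<N. c i * (D ^^ i) r)"
    using OpE[OF assms] by blast
  show ?thesis
    by (rule OpI[of "\<lambda>i. P VarX (c i)"])
       (use c in \<open>auto simp: comm_def P_sum P_mult PX_Dn sum.distrib\<close>)
qed

lemma lead_comm_PX: assumes "lead T d a" shows "lead (comm (P VarX) T) d (P VarX a)"
proof -
  obtain S where S: "S \<in> Op d" "\<And>r. T r = a * (D ^^ d) r + S r" using leadE[OF assms] by blast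
  show ?thesis
    by (rule leadI[OF _ comm_PX_Op[OF S(1)]])
       (use S lead_K[OF assms] Op_K[OF S(1)] in \<open>auto simp: comm_def P_add P_mult PX_Dn\<close>)
qed

section \<open>First integrals and powers of operators\<close>

lemma mult_e_power: "x \<in> K \<Longrightarrow> x * e ^ d = x"
  by (induction d) (auto simp: mult.left_commute[of x e])

lemma derivation_power:
  assumes "\<And>x y. x \<in> K \<Longrightarrow> y \<in> K \<Longrightarrow> \<Delta> (x * y) = \<Delta> x * y + x * \<Delta> y" "a \<in> K"
  shows "\<Delta> (a ^ Suc m) = of_nat (Suc m) * (a ^ m * \<Delta> a)"
proof (induction m)
  case (Suc m)
  have "\<Delta> (a ^ Suc (Suc m)) = \<Delta> a * a ^ Suc m + a * \<Delta> (a ^ Suc m)"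
    using assms(1)[of a "a ^ Suc m"] assms(2) power_K[of a "Suc m"] by simp
  then show ?case unfolding Suc.IH by (simp add: algebra_simps)
qed simp

lemma D_mult_power:
  assumes "x \<in> K" "g \<in> K"
  shows "D (x * g ^ d) = D x * g ^ d + of_nat d * (x * g ^ (d - 1) * D g)"
  using assms(1)
proof (induction d arbitrary: x)
  case (Suc d)
  have "D (x * g * g ^ d) = D (x * g) * g ^ d + of_nat d * (x * g * g ^ (d - 1) * D g)"
    using Suc assms(2) by blast
  moreover have "of_nat d * (x * g * g ^ (d - 1) * D g) = of_nat d * (x * g ^ d * D g)"
    by (cases d) (auto simp: mult.assoc)
  ultimately show ?case using Suc.prems assms(2) by (simp add: D_mult algebra_simps)
qed simp

text \<open>The equation says that n times the logarithmic derivative of \<open>a\<close> equals d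
  times that of \<open>f\<close>, so \<open>a ^ n\<close> divided by \<open>f ^ d\<close> is
  constant. Here \<open>f'\<close> is the inverse of \<open>f\<close>, and no division by
  \<open>a\<close> occurs, as \<open>a\<close> may have zeros.\<close>

lemma first_integral:
  assumes K: "a \<in> K" "f \<in> K" "f' \<in> K" and "f * f' = e" "n \<ge> 1"
    and eq: "of_nat n * (f * D a) = of_nat d * (a * D f)"
  defines "\<kappa> \<equiv> a ^ n * f' ^ d"
  shows "\<kappa> \<in> K" "D \<kappa> = 0" "\<kappa> * f ^ d = a ^ n"
proof -
  have an: "a ^ n \<in> K" using K(1) \<open>n \<ge> 1\<close> by (rule power_K)
  then show "\<kappa> \<in> K" unfolding \<kappa>_def using K by auto
  have "\<kappa> * f ^ d = a ^ n * (f * f') ^ d" by (simp add: \<kappa>_def power_mult_distrib mult_ac)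
  then show "\<kappa> * f ^ d = a ^ n" using mult_e_power[OF an] \<open>f * f' = e\<close> by simp
  obtain m where m: "n = Suc m" using \<open>n \<ge> 1\<close> by (cases n) auto
  have ff: "f' * (f * y) = y" if "y \<in> K" for y
    using that \<open>f * f' = e\<close> by (metis e_mult mult.assoc mult.commute)
  have "D f * f' + f * D f' = 0" using D_mult[of f f'] K \<open>f * f' = e\<close> D_e by simp
  then have "f' * (D f * f') + f' * (f * D f') = 0" by (metis distrib_left mult_zero_right)
  then have Df': "D f' = - (f' * f' * D f)"
    using ff[of "D f'"] K by (simp add: mult_ac eq_neg_iff_add_eq_0 add.commute)
  have "of_nat n * D a = f' * (f * (of_nat n * D a))" using ff[of "of_nat n * D a"] K by auto
  also have "\<dots> = f' * (of_nat d * (a * D f))" using eq by (simp add: mult_ac)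
  finally have Da: "of_nat n * D a = of_nat d * (f' * a * D f)" by (simp add: mult_ac)
  have "D \<kappa> = D (a ^ n) * f' ^ d + of_nat d * (a ^ n * f' ^ (d - 1) * D f')"
    unfolding \<kappa>_def by (rule D_mult_power[OF an K(3)])
  also have "D (a ^ n) = a ^ m * (of_nat n * D a)"
    unfolding m using derivation_power[of D a m] D_mult K by (simp add: mult_ac)
  also have "a ^ m * (of_nat n * D a) * f' ^ d = of_nat d * (a ^ n * f' ^ Suc d * D f)"
    unfolding Da by (simp add: m mult_ac)
  also have "of_nat d * (a ^ n * f' ^ (d - 1) * D f') = - of_nat d * (a ^ n * f' ^ Suc d * D f)"
    unfolding Df' by (cases d) (simp_all add: algebra_simps)
  finally show "D \<kappa> = 0" by simp
qed

text \<open>The commutator with \<open>L\<close> is a derivation for composition. \<open>L\<close>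
  is an arbitrary map, so this serves for \<open>P VarX\<close> as well as for operators.\<close>

lemma comm_comp:
  assumes "T \<in> Op N" "r \<in> K" "S r \<in> K" "S (L r) \<in> K" "L (S r) \<in> K"
  shows "comm L (\<lambda>r. T (S r)) r = comm L T (S r) + T (comm L S r)"
  using Op_diff_arg[OF assms(1), of "L (S r)" "S (L r)"] assms by (simp add: comm_def)

text \<open>The factor \<open>e\<close> matters only for \<open>j = 0\<close>, where the identity
  has leading coefficient \<open>e\<close> and not the ring unit.\<close>

lemma lead_pow:
  assumes "lead C d a" shows "lead (C ^^ j) (j * d) (e * a ^ j)"
proof (induction j)
  case 0
  show ?case by (rule leadI[OF _ Op_zero]) auto
next
  case (Suc j)
  from lead_comp[OF assms this] show ?case
    using lead_K[OF assms] by (simp add: comp_def mult_ac)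
qed

text \<open>By the derivation rule the commutator is a sum of \<open>Suc j\<close> products, each
  with one factor \<open>C\<close> replaced by its commutator. All of them have the same leading
  coefficient \<open>c' * a ^ j\<close>, so they add up without cancellation.\<close>

lemma lead_comm_PX_pow:
  assumes C: "lead C d a" and C': "lead (comm (P VarX) C) c c'"
  shows "lead (comm (P VarX) (C ^^ Suc j)) (c + j * d) (of_nat (Suc j) * (c' * a ^ j))"
proof (induction j)
  case 0
  show ?case using C' by simp
next
  case (Suc j)
  note Cj = lead_pow[OF C, of "Suc j"]
  have "lead (\<lambda>r. comm (P VarX) C ((C ^^ Suc j) r) + C (comm (P VarX) (C ^^ Suc j) r))
      (c + Suc j * d) (c' * (e * a ^ Suc j) + a * (of_nat (Suc j) * (c' * a ^ j)))"
  proof (rule lead_add)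
    show "lead (\<lambda>r. C (comm (P VarX) (C ^^ Suc j) r)) (c + Suc j * d) (a * (of_nat (Suc j) * (c' * a ^ j)))"
      using lead_comp[OF C Suc.IH] by (simp add: add_ac comp_def)
  qed (rule lead_comp[OF C' Cj])
  moreover have "c' * (e * a ^ Suc j) + a * (of_nat (Suc j) * (c' * a ^ j)) = of_nat (Suc (Suc j)) * (c' * a ^ Suc j)"
    using e_mult[OF power_K[OF lead_K[OF C], of "Suc j"]] by (simp add: algebra_simps)
  ultimately have "lead (\<lambda>r. comm (P VarX) C ((C ^^ Suc j) r) + C (comm (P VarX) (C ^^ Suc j) r))
      (c + Suc j * d) (of_nat (Suc (Suc j)) * (c' * a ^ Suc j))" by (simp only:)
  then show ?case
  proof (rule lead_cong)
    fix r assume "r \<in> K"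
    then show "comm (P VarX) (C ^^ Suc (Suc j)) r =
        comm (P VarX) C ((C ^^ Suc j) r) + C (comm (P VarX) (C ^^ Suc j) r)"
      using comm_comp[OF lead_Op[OF C], of r "C ^^ Suc j" "P VarX"] Op_K[OF lead_Op[OF Cj]]
      by (simp add: comp_def)
  qed
qed

text \<open>In the same expansion each product has one factor of order below \<open>N\<close> and
  \<open>j\<close> factors of order at most \<open>d\<close>.\<close>

lemma comm_pow_Op:
  assumes C: "lead C d a" and L: "L \<in> Op M" and LC: "comm L C \<in> Op N"
  shows "comm L (C ^^ Suc j) \<in> Op (N + j * d)"
proof (induction j)
  case 0
  show ?case using LC by simp
next
  case (Suc j)
  note Cj = lead_Op[OF lead_pow[OF C, of "Suc j"]]
  have "(\<lambda>r. comm L C ((C ^^ Suc j) r) + C (comm L (C ^^ Suc j) r)) \<in> Op (N + Suc j * d)"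
  proof (rule Op_add)
    show "(\<lambda>r. comm L C ((C ^^ Suc j) r)) \<in> Op (N + Suc j * d)"
      by (rule Op_mono[OF Op_comp[OF LC Cj]]) auto
    show "(\<lambda>r. C (comm L (C ^^ Suc j) r)) \<in> Op (N + Suc j * d)"
      by (rule Op_mono[OF Op_comp[OF lead_Op[OF C] Suc.IH]]) auto
  qed
  then show ?case
  proof (rule Op_cong)
    fix r assume "r \<in> K"
    then show "comm L (C ^^ Suc (Suc j)) r = comm L C ((C ^^ Suc j) r) + C (comm L (C ^^ Suc j) r)"
      using comm_comp[OF lead_Op[OF C], of r "C ^^ Suc j" L] Op_K[OF Cj] Op_K[OF L]
      by (simp add: comp_def)
  qed
qed

lemma Op_const_mult:
  assumes "T \<in> Op N" "\<kappa> \<in> K" "D \<kappa> = 0" "r \<in> K"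
  shows "T (\<kappa> * r) = \<kappa> * T r"
proof -
  have "(D ^^ i) (\<kappa> * r) = \<kappa> * (D ^^ i) r" for i
    by (induction i) (use assms in \<open>auto simp: D_mult\<close>)
  moreover obtain c where "\<And>i. c i \<in> K" "\<And>r. r \<in> K \<Longrightarrow> T r = (\<Sum>i<N. c i * (D ^^ i) r)"
    using OpE[OF assms(1)] by blast
  ultimately show ?thesis using assms(2,4) by (simp add: sum_distrib_left mult_ac)
qed

text \<open>
  The induction on \<open>d - c\<close> is used twice. Applied to \<open>C\<^sup>n - \<kappa> L\<^sup>d\<close> it yields only \<open>a\<^sup>n\<^sup>-\<^sup>1 c' = 0\<close>,
  and \<open>a\<close> may vanish for some values of \<open>t\<close>. The factor \<open>\<gamma> = c'\<^sup>n / f\<^sup>c\<close>, which depends on \<open>t\<close> only,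
  kills \<open>a\<close>, so the induction hypothesis also applies to \<open>\<gamma> C\<close> and gives \<open>\<gamma> c' = 0\<close>.
\<close>

lemma commuting_lead_x_independent:
  assumes L: "lead L n f" and n: "n \<ge> 1" and f: "f * f' = e" "f' \<in> K"
    and Lx: "\<And>r. r \<in> K \<Longrightarrow> comm (P VarX) L r = 0"
  shows "c \<le> d \<Longrightarrow> C \<in> Op (Suc d) \<Longrightarrow> lead (comm (P VarX) C) c c' \<Longrightarrow> comm L C \<in> Op (n + c - 1)
         \<Longrightarrow> c' = 0"
proof (induction "d - c" arbitrary: d c C c' rule: less_induct)
  case (less d c C c')
  note cd = less.prems(1) and C = less.prems(2) and C' = less.prems(3) and LC = less.prems(4)
  have fK: "f \<in> K" and c'K: "c' \<in> K" using lead_K[OF L] lead_K[OF C'] by auto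
  obtain a where a: "lead C d a" using ex_lead[OF C] by blast
  have aK: "a \<in> K" using lead_K[OF a] .
  \<comment> \<open>The commutator of \<open>P VarX\<close> with \<open>L\<close> vanishes, and
    \<open>P VarX f\<close> is its coefficient at order \<open>n\<close>.\<close>
  have Lf: "P VarX f = 0"
    by (rule lead_eq_zero[OF lead_comm_PX[OF L] Op_cong[OF Op_zero Lx]])
  \<comment> \<open>Jacobi identity: as \<open>P VarX\<close> commutes with \<open>L\<close>, this
    is the commutator of \<open>P VarX\<close> with \<open>comm L C\<close>, and bracketing with
    \<open>P VarX\<close> keeps the order bound.\<close>
  have LC': "comm L (comm (P VarX) C) \<in> Op (n + c - 1)"
  proof (rule Op_cong[OF comm_PX_Op[OF LC]])
    fix r assume r: "r \<in> K"
    have [simp]: "L (P VarX s) = P VarX (L s)" if "s \<in> K" for s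
      using Lx[OF that] by (simp add: comm_def)
    note [simp] = Op_K[OF C] Op_K[OF lead_Op[OF L]]
    show "comm L (comm (P VarX) C) r = comm (P VarX) (comm L C) r"
      using r by (simp add: comm_def P_diff Op_diff_arg[OF lead_Op[OF L]])
  qed
  \<comment> \<open>\<open>comm L C\<close> lies in \<open>Op (n + d - 1)\<close> because
    \<open>c \<le> d\<close>, so its coefficient at order \<open>n + d - 1\<close> is zero. The same
    argument for the x-commutator of \<open>C\<close> gives \<open>eq_c\<close>.\<close>
  have eq_a: "of_nat n * (f * D a) = of_nat d * (a * D f)"
    using lead_eq_zero[OF lead_comm[OF L a] Op_mono[OF LC]] n cd by simp
  have eq_c: "of_nat n * (f * D c') = of_nat c * (c' * D f)"
    using lead_eq_zero[OF lead_comm[OF L C'] LC'] n by simp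
  define \<kappa> where "\<kappa> = a ^ n * f' ^ d"
  define \<gamma> where "\<gamma> = c' ^ n * f' ^ c"
  note \<kappa> = first_integral[OF aK fK f(2,1) n eq_a, folded \<kappa>_def]
  note \<gamma> = first_integral[OF c'K fK f(2,1) n eq_c, folded \<gamma>_def]
  \<comment> \<open>Elements of the kernel of \<open>D\<close> do not depend on x.\<close>
  have \<kappa>X: "P VarX \<kappa> = 0" and \<gamma>X: "P VarX \<gamma> = 0"
    using D_zero_imp_P_zero \<kappa> \<gamma> by auto
  obtain m where m: "n = Suc m" using n by (cases n) auto
  have ac: "of_nat n * (c' * a ^ m) = 0"
  proof (cases "d = c")
    case True
    \<comment> \<open>At equal orders the commutator differentiates the leading coefficient itself,
      so it suffices to differentiate \<open>\<kappa> * f ^ d = a ^ n\<close> by x: the left side is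
      free of x.\<close>
    have "c' = P VarX a" using lead_unique[OF C'] lead_comm_PX[OF a] True by simp
    moreover have "P VarX (\<kappa> * f ^ d) = 0"
    \<comment> \<open>For \<open>d = 0\<close> the power of \<open>f\<close> is the ring unit, to
      which the product rule for \<open>K\<close> may not apply.\<close>
    proof (cases d)
      case 0
      then show ?thesis using \<kappa>X by simp
    next
      case (Suc q)
      have "P VarX (f ^ d) = 0" unfolding Suc
        using derivation_power[of "P VarX" f q] P_mult fK Lf by simp
      then show ?thesis using \<kappa>X \<kappa>(1) fK power_K[of f d] Suc by (simp add: P_mult del: power_Suc)
    qed
    ultimately show ?thesis
      using derivation_power[of "P VarX" a m] P_mult aK \<kappa>(3) by (simp add: m mult_ac del: power_Suc)
  next
    case False
    then have dc: "c < d" using cd by simp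
    \<comment> \<open>Both terms have leading coefficient \<open>a ^ n\<close> at order
      \<open>n * d\<close>. The subtracted one commutes with \<open>L\<close> and with
      \<open>P VarX\<close>, so both commutators of \<open>E\<close> are those of
      \<open>C ^^ n\<close>.\<close>
    define E where "E = (\<lambda>r. (C ^^ n) r - \<kappa> * (L ^^ d) r)"
    have Cn: "lead (C ^^ n) (n * d) (a ^ n)"
      using lead_pow[OF a, of n] power_K[OF aK n] by simp
    have Ld: "lead (\<lambda>r. \<kappa> * (L ^^ d) r) (n * d) (a ^ n)"
    proof -
      have "\<kappa> * (e * f ^ d) = a ^ n" using \<kappa>(1,3) by (simp flip: mult.assoc) (simp add: mult.commute[of _ e])
      then show ?thesis using lead_lmult[OF \<kappa>(1) lead_pow[OF L, of d]] by (simp add: mult.commute)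
    qed
    have E: "E \<in> Op (Suc (n * d - 1))"
      using lead_zero_Op[OF lead_diff[OF Cn Ld, simplified]] n dc by (simp add: E_def)
    have Lj: "comm (P VarX) (L ^^ j) r = 0 \<and> comm L (L ^^ j) r = 0" if "r \<in> K" for r j
      using that
    proof (induction j)
      case (Suc j)
      have "(L ^^ j) r \<in> K" using Op_K[OF lead_Op[OF lead_pow[OF L]]] Suc.prems by blast
      then show ?case using Suc Lx[of "(L ^^ j) r"] by (simp add: comm_def)
    qed (simp add: comm_def)
    note LdK = Op_K[OF lead_Op[OF lead_pow[OF L, of d]]]
    have E': "lead (comm (P VarX) E) (c + m * d) (of_nat n * (c' * a ^ m))"
    proof (rule lead_cong[OF lead_comm_PX_pow[OF a C', of m, folded m]])
      fix r assume r: "r \<in> K"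
      then show "comm (P VarX) E r = comm (P VarX) (C ^^ n) r"
        using Lj[OF r, of d] \<kappa>X \<kappa>(1) LdK Op_K[OF lead_Op[OF Cn]]
        by (simp add: comm_def E_def P_diff P_mult)
    qed
    have LE: "comm L E \<in> Op (n + (c + m * d) - 1)"
    proof (rule Op_cong)
      show "comm L (C ^^ n) \<in> Op (n + (c + m * d) - 1)"
        using comm_pow_Op[OF a lead_Op[OF L] LC, of m] n by (simp add: m add.assoc)
      fix r assume r: "r \<in> K"
      show "comm L E r = comm L (C ^^ n) r"
        using Lj[OF r, of d] r LdK Op_K[OF lead_Op[OF Cn]] \<kappa>(1)
        by (simp add: comm_def E_def Op_diff_arg[OF lead_Op[OF L]] Op_const_mult[OF lead_Op[OF L] \<kappa>(1,2)])
    qed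
    \<comment> \<open>The order of \<open>E\<close> is at most \<open>n * d - 1\<close> and that of
      its x-commutator at most \<open>c + m * d\<close>, so the gap is now
      \<open>d - c - 1\<close>.\<close>
    have "c + m * d \<le> n * d - 1" "n * d - 1 - (c + m * d) < d - c" using dc by (auto simp: m)
    then show ?thesis using less.hyps[OF _ _ E E' LE] by simp
  qed
  have ac': "c' * a ^ m = 0"
    using torsion_free[of "c' * a ^ m" m] ac aK c'K by (simp add: m)
  have "a * c' = 0"
  proof (rule nilpotent_zero)
    have "(a * c') ^ n = a * c' ^ m * (c' * a ^ m)" by (simp add: m power_mult_distrib mult_ac)
    then show "(a * c') ^ n = 0" using ac' by simp
  qed (use aK c'K in auto)
  moreover have "\<gamma> * a = (a * c') * (c' ^ m * f' ^ c)" by (simp add: \<gamma>_def m mult_ac)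
  ultimately have "\<gamma> * a = 0" by simp
  \<comment> \<open>As \<open>\<gamma>\<close> contains the factor \<open>c'\<close>, it kills
    \<open>a\<close>, and this operator has order at most \<open>d - 1\<close>. Its x-commutator
    still sits at order \<open>c\<close>, so the gap shrinks again; for \<open>d = c\<close> that
    commutator has order below \<open>c\<close> at once.\<close>
  define E where "E = (\<lambda>r. \<gamma> * C r)"
  have E: "E \<in> Op d"
    using lead_zero_Op lead_lmult[OF \<gamma>(1) a] \<open>\<gamma> * a = 0\<close> by (simp add: E_def)
  have E': "lead (comm (P VarX) E) c (\<gamma> * c')"
    by (rule lead_cong[OF lead_lmult[OF \<gamma>(1) C']])
       (use \<gamma>(1) \<gamma>X Op_K[OF C] in \<open>auto simp: comm_def E_def P_mult algebra_simps\<close>)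
  have LE: "comm L E \<in> Op (n + c - 1)"
    by (rule Op_cong[OF Op_lmult[OF \<gamma>(1) LC]])
       (use Op_K[OF C] in \<open>auto simp: comm_def E_def Op_const_mult[OF lead_Op[OF L] \<gamma>(1,2)] algebra_simps\<close>)
  have "\<gamma> * c' = 0"
  proof (cases "d = c")
    case True
    then show ?thesis using lead_eq_zero[OF E' Op_mono[OF comm_PX_Op[OF E]]] by simp
  next
    case False
    then have *: "E \<in> Op (Suc (d - 1))" "d - 1 - c < d - c" "c \<le> d - 1" using E cd by auto
    show ?thesis by (rule less.hyps[OF *(2,3,1) E' LE])
  qed
  \<comment> \<open>Since \<open>\<gamma> * f ^ c = c' ^ n\<close>, the equation just obtained makes
    \<open>c'\<close> nilpotent.\<close>
  moreover have "\<gamma> * f ^ c * c' = (\<gamma> * c') * f ^ c" by (simp add: mult_ac)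
  ultimately have "\<gamma> * f ^ c * c' = 0" by simp
  then have "c' ^ Suc n = 0" unfolding \<gamma>(3) by (simp add: mult.commute)
  then show ?case using nilpotent_zero[OF c'K] by blast
qed

subsection \<open>Linearization and symmetries\<close>

text \<open>The linearization of \<open>h\<close> applied to \<open>r\<close>, summed over the
  finite support as in \<open>D\<close>.\<close>

definition Fr :: "'a \<Rightarrow> 'a \<Rightarrow> 'a" where
  "Fr h r = (\<Sum>i | P (VarU i) h \<noteq> 0. P (VarU i) h * (D ^^ i) r)"

lemma Fr_eq:
  assumes "ubound m h" shows "Fr h r = (\<Sum>i<m. P (VarU i) h * (D ^^ i) r)"
  unfolding Fr_def using assms
  by (intro sum.mono_neutral_left) (auto simp: ubound_def not_less[symmetric])

lemma Fr_Op: assumes "h \<in> K" "ubound m h" shows "Fr h \<in> Op m"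
  by (rule OpI[of "\<lambda>i. P (VarU i) h"]) (use assms in \<open>auto simp: Fr_eq\<close>)

lemma Fr_K [simp, intro]: "h \<in> K \<Longrightarrow> r \<in> K \<Longrightarrow> Fr h r \<in> K"
  unfolding Fr_def by auto

lemma lead_Fr:
  assumes "h \<in> K" "ubound (Suc m) h" shows "lead (Fr h) m (P (VarU m) h)"
proof (rule leadI)
  show "(\<lambda>r. \<Sum>i<m. P (VarU i) h * (D ^^ i) r) \<in> Op m"
    using assms by (intro Op_sum Op_monomial) auto
qed (use assms in \<open>auto simp: Fr_eq\<close>)

lemma Fr_add:
  assumes "a \<in> K" "b \<in> K" shows "Fr (a + b) r = Fr a r + Fr b r"
proof -
  obtain l m where "ubound l a" "ubound m b" using assms ex_ubound by meson
  then have *: "ubound (max l m) a" "ubound (max l m) b" by (auto intro: ubound_mono)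
  show ?thesis
    using Fr_eq[OF *(1)] Fr_eq[OF *(2)] Fr_eq[OF ubound_add[OF assms *]]
    by (simp add: P_add assms sum.distrib algebra_simps)
qed

lemma Fr_mult:
  assumes "a \<in> K" "b \<in> K" shows "Fr (a * b) r = a * Fr b r + b * Fr a r"
proof -
  obtain l m where "ubound l a" "ubound m b" using assms ex_ubound by meson
  then have *: "ubound (max l m) a" "ubound (max l m) b" by (auto intro: ubound_mono)
  show ?thesis
    using Fr_eq[OF *(1)] Fr_eq[OF *(2)] Fr_eq[OF ubound_mult[OF assms *]]
    by (simp add: P_mult assms sum.distrib algebra_simps sum_distrib_left)
qed

lemma Fr_zero [simp]: "Fr 0 r = 0"
  by (simp add: Fr_def)

lemma Fr_zero_right [simp]: "Fr h 0 = 0"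
  by (simp add: Fr_def)

lemma Fr_diff: "a \<in> K \<Longrightarrow> b \<in> K \<Longrightarrow> Fr (a - b) r = Fr a r - Fr b r"
  using Fr_add[of "a - b" b r] by simp

lemma Fr_sum: "(\<And>i. i \<in> I \<Longrightarrow> f i \<in> K) \<Longrightarrow> Fr (sum f I) r = (\<Sum>i\<in>I. Fr (f i) r)"
  by (induction I rule: infinite_finite_induct) (auto simp: Fr_add)

text \<open>By \<open>P_D\<close> each coefficient of the linearization of \<open>D a\<close> is the
  total derivative of a coefficient of \<open>a\<close> plus the preceding coefficient; these are
  the two terms of the product rule for \<open>D (Fr a r)\<close>.\<close>

lemma Fr_D:
  assumes a: "a \<in> K" and r: "r \<in> K" shows "Fr (D a) r = D (Fr a r)"
proof -
  obtain m where m: "ubound m a" using ex_ubound a by blast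
  have "ubound (Suc m) (D a)"
    unfolding ubound_def
  proof (intro allI impI)
    fix i assume "i \<ge> Suc m"
    then obtain j where "i = Suc j" "j \<ge> m" by (cases i) auto
    then show "P (VarU i) (D a) = 0" using a m by (simp add: P_D ubound_def)
  qed
  then have "Fr (D a) r = (\<Sum>i<Suc m. P (VarU i) (D a) * (D ^^ i) r)" by (rule Fr_eq)
  also have "\<dots> = (\<Sum>i<Suc m. D (P (VarU i) a) * (D ^^ i) r)
      + (\<Sum>i<Suc m. (case i of Suc j \<Rightarrow> P (VarU j) a | _ \<Rightarrow> 0) * (D ^^ i) r)"
    by (simp only: sum.distrib[symmetric] distrib_right[symmetric]) (simp add: P_D[OF a])
  also have "(\<Sum>i<Suc m. D (P (VarU i) a) * (D ^^ i) r) = (\<Sum>i<m. D (P (VarU i) a) * (D ^^ i) r)"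
    using uboundD[OF m, of m] by simp
  also have "(\<Sum>i<Suc m. (case i of Suc j \<Rightarrow> P (VarU j) a | _ \<Rightarrow> 0) * (D ^^ i) r)
      = (\<Sum>i<m. P (VarU i) a * (D ^^ Suc i) r)"
    by (subst sum.lessThan_Suc_shift) simp
  also have "(\<Sum>i<m. D (P (VarU i) a) * (D ^^ i) r) + (\<Sum>i<m. P (VarU i) a * (D ^^ Suc i) r) = D (Fr a r)"
    using a r by (simp add: Fr_eq[OF m] D_sum D_mult sum.distrib)
  finally show ?thesis .
qed

lemma Fr_Dn: "a \<in> K \<Longrightarrow> r \<in> K \<Longrightarrow> Fr ((D ^^ i) a) r = (D ^^ i) (Fr a r)"
  by (induction i) (auto simp: Fr_D)

lemma comm_PX_Fr:
  assumes "h \<in> K" "r \<in> K" shows "comm (P VarX) (Fr h) r = Fr (P VarX h) r"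
proof -
  obtain m where m: "ubound m h" using ex_ubound assms by blast
  show ?thesis
    using assms
    by (simp add: Fr_eq[OF m] Fr_eq[OF ubound_P[OF assms(1) m]] comm_def P_sum P_mult PX_Dn
        sum.distrib P_commute[of h "VarU _" VarX])
qed

section \<open>Symmetries and the order of their x-derivatives\<close>

text \<open>By the product rule, linearizing \<open>Fr F G\<close> varies either \<open>G\<close>,
  which gives the composition of the two linearizations, or the coefficients of \<open>Fr F\<close>.
  The latter part involves no coordinates beyond those of \<open>F\<close>.\<close>

lemma Fr_Fr:
  assumes "F \<in> K" "G \<in> K" "ubound N F"
  shows "(\<lambda>r. Fr (Fr F G) r - Fr F (Fr G r)) \<in> Op N"
proof -
  have "(\<lambda>r. \<Sum>i<N. (D ^^ i) G * Fr (P (VarU i) F) r) \<in> Op N"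
    using assms by (intro Op_sum Op_lmult Fr_Op ubound_P) auto
  then show ?thesis
    by (rule Op_cong)
       (use assms in \<open>simp add: Fr_eq[OF assms(3)] Fr_sum Fr_mult Fr_Dn sum.distrib\<close>)
qed

text \<open>The linearized determining equation bounds the order of the commutator of
  \<open>Fr F\<close> and \<open>Fr G\<close> by \<open>max n k\<close>. The operator lemma at order
  \<open>M\<close> needs this to be at most \<open>n + M - 2\<close>, that is,
  \<open>M \<ge> 2\<close> and \<open>M \<ge> k + 2 - n\<close>: hence the threshold.\<close>

lemma symmetry_PX_ubound:
  assumes F: "F \<in> K" "ubound (Suc n) F" "P VarX F = 0"
    and f: "P (VarU n) F * f' = e" "f' \<in> K" and n: "n \<ge> 1"
    and G: "G \<in> K" "ubound (Suc k) G"
    and sym: "P VarT G = Fr F G - Fr G F"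
  shows "ubound (max 2 (k + 2 - n)) (P VarX G)"
proof (cases "max 2 (k + 2 - n) \<le> Suc k")
  case False
  show ?thesis by (rule ubound_mono[OF ubound_P[OF G]]) (use False in arith)
next
  case True
  have comm: "comm (Fr F) (Fr G) \<in> Op (Suc (max n k))"
  proof -
    have "ubound (Suc k) (P VarT G)" using ubound_P G by blast
    then have 1: "Fr (P VarT G) \<in> Op (Suc (max n k))"
      using Op_mono[OF Fr_Op] G by (metis P_K Suc_le_mono max.cobounded2)
    have 2: "(\<lambda>r. Fr (Fr F G) r - Fr F (Fr G r)) \<in> Op (Suc (max n k))"
      by (rule Op_mono[OF Fr_Fr[OF F(1) G(1) F(2)]]) simp
    have 3: "(\<lambda>r. Fr (Fr G F) r - Fr G (Fr F r)) \<in> Op (Suc (max n k))"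
      by (rule Op_mono[OF Fr_Fr[OF G(1) F(1) G(2)]]) simp
    show ?thesis
      by (rule Op_cong[OF Op_add[OF Op_diff[OF 1 2] 3]]) (use F G in \<open>simp add: comm_def sym Fr_diff\<close>)
  qed
  show ?thesis
    using True
  \<comment> \<open>Descent from \<open>Suc k\<close>: the hypothesis \<open>ubound (Suc M)\<close>
    makes the derivative by \<open>VarU M\<close> the leading coefficient of
    \<open>Fr (P VarX G)\<close>, which is the x-commutator of \<open>Fr G\<close>.\<close>
  proof (induction rule: inc_induct)
    case base
    show ?case by (rule ubound_P[OF G])
  next
    case (step M)
    have "P (VarU M) (P VarX G) = 0"
    proof (rule commuting_lead_x_independent)
      show "lead (Fr F) n (P (VarU n) F)" by (rule lead_Fr) fact+
      show "comm (P VarX) (Fr F) r = 0" if "r \<in> K" for r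
        using comm_PX_Fr[OF F(1) that] F(3) by simp
      show "M \<le> k" using step by simp
      show "Fr G \<in> Op (Suc k)" using Fr_Op G by blast
      show "lead (comm (P VarX) (Fr G)) M (P (VarU M) (P VarX G))"
        by (rule lead_cong[OF lead_Fr]) (use G step comm_PX_Fr in auto)
      show "comm (Fr F) (Fr G) \<in> Op (n + M - 1)"
        by (rule Op_mono[OF comm]) (use step n in auto)
    qed fact+
    then show ?case using step.IH
      by (auto simp: ubound_def) (metis le_antisym not_less_eq_eq)
  qed
qed

text \<open>As \<open>F\<close> is free of x, \<open>P VarX\<close> commutes with
  \<open>Fr F\<close> and annihilates \<open>F\<close>, so it can be applied to the determining
  equation.\<close>

lemma symmetry_PX:
  assumes "F \<in> K" "P VarX F = 0" "G \<in> K" "P VarT G = Fr F G - Fr G F"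
  shows "P VarT (P VarX G) = Fr F (P VarX G) - Fr (P VarX G) F"
  using comm_PX_Fr[of F G] comm_PX_Fr[of G F] assms
  by (simp add: P_commute[of G VarT] P_diff comm_def)

lemma PXn_K [simp, intro]: "G \<in> K \<Longrightarrow> (P VarX ^^ j) G \<in> K"
  by (induction j) auto

lemma symmetry_PXn:
  assumes "F \<in> K" "P VarX F = 0" "G \<in> K" "P VarT G = Fr F G - Fr G F"
  shows "P VarT ((P VarX ^^ j) G) = Fr F ((P VarX ^^ j) G) - Fr ((P VarX ^^ j) G) F"
  by (induction j) (use assms symmetry_PX[OF assms(1,2)] in auto)

lemma symmetry_PXn_ubound:
  assumes F: "F \<in> K" "ubound (Suc n) F" "P VarX F = 0"
    and f: "P (VarU n) F * f' = e" "f' \<in> K" and n: "n \<ge> 2"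
    and G: "G \<in> K" "ubound (Suc k) G"
    and sym: "P VarT G = Fr F G - Fr G F"
  shows "ubound (max 2 (Suc (k - j * (n - 1)))) ((P VarX ^^ j) G)"
proof (induction j)
  case 0
  show ?case using ubound_mono[OF G(2)] by simp
next
  case (Suc j)
  \<comment> \<open>The order counted for the next step never falls below 1, since nothing is
    claimed about \<open>u 0\<close> and \<open>u 1\<close>.\<close>
  define l where "l = max 1 (k - j * (n - 1))"
  have l: "max 2 (Suc (k - j * (n - 1))) = Suc l" by (simp add: l_def)
  have "ubound (max 2 (l + 2 - n)) (P VarX ((P VarX ^^ j) G))"
    by (rule symmetry_PX_ubound[OF F f _ _ Suc.IH[unfolded l] symmetry_PXn[OF F(1,3) G(1) sym]])
       (use n G in auto)
  moreover have "max 2 (l + 2 - n) \<le> max 2 (Suc (k - Suc j * (n - 1)))"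
    unfolding l_def using n by (simp add: max_def) linarith
  ultimately show ?case using ubound_mono by auto
qed

end

section \<open>Smooth functions on jet space\<close>

lemma minus_fun_app [simp]: "(f - g) x = f x - g x" "(- f) x = - f x" for f g :: "'b \<Rightarrow> 'c::ab_group_add"
  by (simp_all add: fun_diff_def fun_Compl_def)

lemma pdiff_cong_ev:
  assumes "\<forall>\<^sub>F y in nhds (p v). f (p(v := y)) = g (q(v := y))" "p v = q v"
  shows "pdiff v f p = pdiff v g q"
  unfolding pdiff_def using assms by (intro deriv_cong_ev) auto

section \<open>Partial derivatives of smooth functions on a box\<close>

locale jet_box =
  fixes \<Omega> :: "jet set" and B :: "jet_var \<Rightarrow> real set"
  assumes open_B: "open (B v)" and interval_B: "is_interval (B v)"
    and \<Omega>_eq: "\<Omega> = {p. \<forall>v. p v \<in> B v}"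
begin

lemma mem_B: "p \<in> \<Omega> \<Longrightarrow> p v \<in> B v"
  by (simp add: \<Omega>_eq)

lemma upd_mem: "p \<in> \<Omega> \<Longrightarrow> y \<in> B v \<Longrightarrow> p(v := y) \<in> \<Omega>"
  by (simp add: \<Omega>_eq)

lemma eventually_B: "p \<in> \<Omega> \<Longrightarrow> \<forall>\<^sub>F y in nhds (p v). y \<in> B v"
  using open_B mem_B by (simp add: eventually_nhds_in_open)

lemma pdiff_cong:
  assumes "\<And>q. q \<in> \<Omega> \<Longrightarrow> f q = g q" "p \<in> \<Omega>"
  shows "pdiff v f p = pdiff v g p"
  by (rule pdiff_cong_ev)
     (use assms upd_mem in \<open>auto intro: eventually_mono[OF eventually_B]\<close>)

lemma smooth_continuous: "jet_smooth \<Omega> f \<Longrightarrow> continuous_on \<Omega> f"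
  unfolding jet_smooth_def by (metis foldr.simps(1) id_apply)

lemma smooth_pdiff:
  assumes "jet_smooth \<Omega> f" shows "jet_smooth \<Omega> (pdiff v f)"
proof -
  have "foldr pdiff vs (pdiff v f) = foldr pdiff (vs @ [v]) f" for vs by simp
  then show ?thesis using assms unfolding jet_smooth_def by metis
qed

lemma smooth_has_pdiff:
  assumes "jet_smooth \<Omega> f" "p \<in> \<Omega>"
  shows "((\<lambda>y. f (p(v := y))) has_real_derivative pdiff v f p) (at (p v))"
proof -
  have "(\<lambda>y. foldr pdiff [] f (p(v := y))) differentiable at (p v)"
    using assms unfolding jet_smooth_def by blast
  then show ?thesis
    by (simp add: pdiff_def DERIV_deriv_iff_real_differentiable)
qed

lemma smooth_has_pdiff_upd:
  assumes "jet_smooth \<Omega> f" "p \<in> \<Omega>" "y \<in> B v"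
  shows "((\<lambda>z. f (p(v := z))) has_real_derivative pdiff v f (p(v := y))) (at y)"
  using smooth_has_pdiff[OF assms(1) upd_mem[OF assms(2,3)], of v] by simp

section \<open>Closure properties of smooth functions\<close>

text \<open>Coinduction for smoothness: if a class of continuous functions contains the partial
  derivatives of its members, then all iterated derivatives stay in it. Agreement on
  \<open>\<Omega>\<close> suffices, because \<open>\<Omega>\<close> is open along every coordinate
  line.\<close>

lemma smooth_coinduct:
  assumes "S f"
    and cont: "\<And>f. S f \<Longrightarrow> continuous_on \<Omega> f"
    and step: "\<And>f v. S f \<Longrightarrow> \<exists>g. S g \<and> (\<forall>p\<in>\<Omega>. ((\<lambda>y. f (p(v := y))) has_real_derivative g p) (at (p v)))"
  shows "jet_smooth \<Omega> f"
proof -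
  have *: "\<exists>g. S g \<and> (\<forall>p\<in>\<Omega>. foldr pdiff vs f p = g p)" for vs
  proof (induction vs)
    case Nil
    then show ?case using \<open>S f\<close> by auto
  next
    case (Cons v vs)
    then obtain g where g: "S g" "\<forall>p\<in>\<Omega>. foldr pdiff vs f p = g p" by blast
    obtain h where h: "S h" "\<forall>p\<in>\<Omega>. ((\<lambda>y. g (p(v := y))) has_real_derivative h p) (at (p v))"
      using step[OF g(1), of v] by blast
    have "foldr pdiff (v # vs) f p = h p" if p: "p \<in> \<Omega>" for p
    proof -
      have "foldr pdiff (v # vs) f p = pdiff v g p" using g p by (auto intro: pdiff_cong)
      also have "\<dots> = h p" unfolding pdiff_def using h p by (auto intro: DERIV_imp_deriv)
      finally show ?thesis .
    qed
    then show ?case using h by blast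
  qed
  show ?thesis
    unfolding jet_smooth_def
  proof (intro allI conjI ballI)
    fix vs
    obtain g where g: "S g" "\<forall>p\<in>\<Omega>. foldr pdiff vs f p = g p" using * by blast
    show "continuous_on \<Omega> (foldr pdiff vs f)"
      using cont[OF g(1)] g(2) by (simp cong: continuous_on_cong)
    fix v p assume p: "p \<in> \<Omega>"
    obtain h where "((\<lambda>y. g (p(v := y))) has_real_derivative h p) (at (p v))"
      using step[OF g(1), of v] p by blast
    then have "((\<lambda>y. foldr pdiff vs f (p(v := y))) has_real_derivative h p) (at (p v))"
    proof (rule has_field_derivative_transform_within_open)
      show "open (B v)" "p v \<in> B v" using open_B mem_B[OF p] by auto
      show "g (p(v := y)) = foldr pdiff vs f (p(v := y))" if "y \<in> B v" for y
        using g(2) upd_mem[OF p that] by simp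
    qed
    then show "(\<lambda>y. foldr pdiff vs f (p(v := y))) differentiable at (p v)"
      using real_differentiable_def by blast
  qed
qed

lemma smooth_cong:
  assumes "jet_smooth \<Omega> f" "\<And>p. p \<in> \<Omega> \<Longrightarrow> f p = g p"
  shows "jet_smooth \<Omega> g"
proof (rule smooth_coinduct[where S = "\<lambda>g. \<exists>f. jet_smooth \<Omega> f \<and> (\<forall>p\<in>\<Omega>. f p = g p)"])
  show "\<exists>f. jet_smooth \<Omega> f \<and> (\<forall>p\<in>\<Omega>. f p = g p)" using assms by blast
  fix h v assume "\<exists>f. jet_smooth \<Omega> f \<and> (\<forall>p\<in>\<Omega>. f p = h p)"
  then obtain f where f: "jet_smooth \<Omega> f" "\<And>p. p \<in> \<Omega> \<Longrightarrow> f p = h p" by blast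
  show "continuous_on \<Omega> h"
    using smooth_continuous[OF f(1)] f(2) by (simp cong: continuous_on_cong)
  have "((\<lambda>y. h (p(v := y))) has_real_derivative pdiff v f p) (at (p v))" if p: "p \<in> \<Omega>" for p
    using smooth_has_pdiff[OF f(1) p]
  proof (rule has_field_derivative_transform_within_open)
    show "open (B v)" "p v \<in> B v" using open_B mem_B[OF p] by auto
    show "f (p(v := y)) = h (p(v := y))" if "y \<in> B v" for y
      using f(2) upd_mem[OF p that] by simp
  qed
  then show "\<exists>g. (\<exists>f. jet_smooth \<Omega> f \<and> (\<forall>p\<in>\<Omega>. f p = g p)) \<and>
      (\<forall>p\<in>\<Omega>. ((\<lambda>y. h (p(v := y))) has_real_derivative g p) (at (p v)))"
    using smooth_pdiff[OF f(1)] by blast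
qed

lemma smooth_const: "jet_smooth \<Omega> (\<lambda>_. c)"
proof (rule smooth_coinduct[where S = "\<lambda>f. \<exists>c. f = (\<lambda>_. c)"])
  fix f :: "jet \<Rightarrow> real" and v assume "\<exists>c. f = (\<lambda>_. c)"
  then show "\<exists>g. (\<exists>c. g = (\<lambda>_. c)) \<and> (\<forall>p\<in>\<Omega>. ((\<lambda>y. f (p(v := y))) has_real_derivative g p) (at (p v)))"
    by (intro exI[of _ "\<lambda>_. 0"]) auto
qed (auto intro: continuous_intros)

lemma smooth_coord: "jet_smooth \<Omega> (\<lambda>p. p w)"
proof (rule smooth_coinduct[where S = "\<lambda>f. jet_smooth \<Omega> f \<or> f = (\<lambda>p. p w)"])
  fix f :: "jet \<Rightarrow> real" and v assume f: "jet_smooth \<Omega> f \<or> f = (\<lambda>p. p w)"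
  show "continuous_on \<Omega> f"
    using f smooth_continuous continuous_on_subset[OF continuous_on_product_coordinates subset_UNIV] by auto
  show "\<exists>g. (jet_smooth \<Omega> g \<or> g = (\<lambda>p. p w)) \<and>
      (\<forall>p\<in>\<Omega>. ((\<lambda>y. f (p(v := y))) has_real_derivative g p) (at (p v)))"
    using f
  proof
    assume "f = (\<lambda>p. p w)"
    then show ?thesis
      by (intro exI[of _ "\<lambda>_. if v = w then 1 else 0"])
         (auto intro!: smooth_const DERIV_ident[unfolded id_def])
  next
    assume "jet_smooth \<Omega> f"
    then show ?thesis using smooth_pdiff smooth_has_pdiff by blast
  qed
qed auto

text \<open>Smooth functions and \<open>1 / f\<close> generate an algebra that is closed under
  partial derivatives, since the derivative of \<open>1 / f\<close> is again a polynomial in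
  \<open>1 / f\<close> and a derivative of \<open>f\<close>. So it can serve as the class in
  \<open>smooth_coinduct\<close>, without formulas for higher derivatives.\<close>

inductive smooth_gen :: "(jet \<Rightarrow> real) \<Rightarrow> (jet \<Rightarrow> real) \<Rightarrow> bool" for f where
  base: "jet_smooth \<Omega> g \<Longrightarrow> smooth_gen f g"
| add: "smooth_gen f g \<Longrightarrow> smooth_gen f h \<Longrightarrow> smooth_gen f (\<lambda>p. g p + h p)"
| mult: "smooth_gen f g \<Longrightarrow> smooth_gen f h \<Longrightarrow> smooth_gen f (\<lambda>p. g p * h p)"
| inv: "smooth_gen f (\<lambda>p. inverse (f p))"

lemma smooth_gen_smooth:
  assumes f: "jet_smooth \<Omega> f" "\<And>p. p \<in> \<Omega> \<Longrightarrow> f p \<noteq> 0" and g: "smooth_gen f g"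
  shows "jet_smooth \<Omega> g"
proof (rule smooth_coinduct[where S = "smooth_gen f"])
  show "smooth_gen f g" by fact
  fix g v assume g: "smooth_gen f g"
  show "continuous_on \<Omega> g"
    using g
  proof induction
    case inv
    then show ?case using f by (intro continuous_on_inverse smooth_continuous) auto
  qed (auto intro: smooth_continuous continuous_on_add continuous_on_mult)
  show "\<exists>h. smooth_gen f h \<and> (\<forall>p\<in>\<Omega>. ((\<lambda>y. g (p(v := y))) has_real_derivative h p) (at (p v)))"
    using g
  proof induction
    case (base g)
    then show ?case using smooth_pdiff smooth_has_pdiff smooth_gen.base by blast
  next
    case (add g h)
    then obtain g' h' where *: "smooth_gen f g'" "smooth_gen f h'"
      "\<forall>p\<in>\<Omega>. ((\<lambda>y. g (p(v := y))) has_real_derivative g' p) (at (p v))"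
      "\<forall>p\<in>\<Omega>. ((\<lambda>y. h (p(v := y))) has_real_derivative h' p) (at (p v))" by metis
    show ?case
    proof (intro exI[of _ "\<lambda>p. g' p + h' p"] conjI ballI)
      show "smooth_gen f (\<lambda>p. g' p + h' p)" by (intro smooth_gen.add *)
      show "((\<lambda>y. g (p(v := y)) + h (p(v := y))) has_real_derivative (g' p + h' p)) (at (p v))"
        if "p \<in> \<Omega>" for p
        by (rule DERIV_add[OF *(3)[rule_format, OF that] *(4)[rule_format, OF that]])
    qed
  next
    case (mult g h)
    then obtain g' h' where *: "smooth_gen f g'" "smooth_gen f h'"
      "\<forall>p\<in>\<Omega>. ((\<lambda>y. g (p(v := y))) has_real_derivative g' p) (at (p v))"
      "\<forall>p\<in>\<Omega>. ((\<lambda>y. h (p(v := y))) has_real_derivative h' p) (at (p v))" by metis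
    show ?case
    proof (intro exI[of _ "\<lambda>p. g' p * h p + h' p * g p"] conjI ballI)
      show "smooth_gen f (\<lambda>p. g' p * h p + h' p * g p)"
        by (intro smooth_gen.add smooth_gen.mult * mult.hyps)
      show "((\<lambda>y. g (p(v := y)) * h (p(v := y))) has_real_derivative (g' p * h p + h' p * g p)) (at (p v))"
        if "p \<in> \<Omega>" for p
        using DERIV_mult[OF *(3)[rule_format, OF that] *(4)[rule_format, OF that]] by simp
    qed
  next
    case inv
    have "((\<lambda>y. inverse (f (p(v := y)))) has_real_derivative
        (- 1 * (inverse (f p) * (inverse (f p) * pdiff v f p)))) (at (p v))" if "p \<in> \<Omega>" for p
      using DERIV_inverse'[OF smooth_has_pdiff[OF f(1) that], of v] f(2)[OF that] by (simp add: mult_ac)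
    moreover have "smooth_gen f (\<lambda>p. - 1 * (inverse (f p) * (inverse (f p) * pdiff v f p)))"
      by (rule smooth_gen.mult[OF smooth_gen.base[OF smooth_const] smooth_gen.mult[OF smooth_gen.inv
            smooth_gen.mult[OF smooth_gen.inv smooth_gen.base[OF smooth_pdiff[OF f(1)]]]]])
    ultimately show ?case by (intro exI conjI ballI)
  qed
qed

lemma smooth_add: "jet_smooth \<Omega> f \<Longrightarrow> jet_smooth \<Omega> g \<Longrightarrow> jet_smooth \<Omega> (\<lambda>p. f p + g p)"
  \<comment> \<open>The constant 1 is merely a nowhere vanishing choice for
    \<open>f\<close>.\<close>
  by (rule smooth_gen_smooth[of "\<lambda>_. 1"]) (auto intro: smooth_gen.base smooth_gen.add smooth_const)

lemma smooth_mult: "jet_smooth \<Omega> f \<Longrightarrow> jet_smooth \<Omega> g \<Longrightarrow> jet_smooth \<Omega> (\<lambda>p. f p * g p)"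
  by (rule smooth_gen_smooth[of "\<lambda>_. 1"]) (auto intro: smooth_gen.base smooth_gen.mult smooth_const)

lemma smooth_inverse:
  "jet_smooth \<Omega> f \<Longrightarrow> (\<And>p. p \<in> \<Omega> \<Longrightarrow> f p \<noteq> 0) \<Longrightarrow> jet_smooth \<Omega> (\<lambda>p. inverse (f p))"
  by (rule smooth_gen_smooth) (auto intro: smooth_gen.inv)

lemma smooth_uminus: "jet_smooth \<Omega> f \<Longrightarrow> jet_smooth \<Omega> (\<lambda>p. - f p)"
  using smooth_mult[OF smooth_const[of "- 1"]] by simp

lemma smooth_diff: "jet_smooth \<Omega> f \<Longrightarrow> jet_smooth \<Omega> g \<Longrightarrow> jet_smooth \<Omega> (\<lambda>p. f p - g p)"
  using smooth_add[of f "\<lambda>p. - g p"] smooth_uminus by simp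

lemma smooth_sum: "(\<And>i. i \<in> I \<Longrightarrow> jet_smooth \<Omega> (f i)) \<Longrightarrow> jet_smooth \<Omega> (\<lambda>p. \<Sum>i\<in>I. f i p)"
  by (induction I rule: infinite_finite_induct) (auto intro: smooth_add smooth_const)

lemma smooth_power: "jet_smooth \<Omega> f \<Longrightarrow> jet_smooth \<Omega> (\<lambda>p. f p ^ n)"
  by (induction n) (auto intro: smooth_mult smooth_const)

lemma continuous_on_upd: "continuous_on S (\<lambda>p::jet. p(w := c))"
proof (rule continuous_on_coordinatewise_then_product)
  show "continuous_on S (\<lambda>p::jet. (p(w := c)) i)" for i
    by (cases "i = w") (auto intro: continuous_on_subset[OF continuous_on_product_coordinates subset_UNIV])
qed

text \<open>Freezing commutes with derivatives in the other coordinates and makes the derivative by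
  \<open>w\<close> zero. It supplies the Taylor coefficients at a fixed x.\<close>

lemma smooth_freeze:
  assumes "jet_smooth \<Omega> f" and c: "c \<in> B w"
  shows "jet_smooth \<Omega> (\<lambda>p. f (p(w := c)))"
proof (rule smooth_coinduct[where S = "\<lambda>g. \<exists>f. jet_smooth \<Omega> f \<and> g = (\<lambda>p. f (p(w := c)))"])
  fix g v assume "\<exists>f. jet_smooth \<Omega> f \<and> g = (\<lambda>p. f (p(w := c)))"
  then obtain f where f: "jet_smooth \<Omega> f" "g = (\<lambda>p. f (p(w := c)))" by blast
  show "continuous_on \<Omega> g"
    unfolding f(2) by (rule continuous_on_compose2[OF smooth_continuous[OF f(1)] continuous_on_upd])
      (use upd_mem c in auto)
  show "\<exists>h. (\<exists>f. jet_smooth \<Omega> f \<and> h = (\<lambda>p. f (p(w := c)))) \<and>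
      (\<forall>p\<in>\<Omega>. ((\<lambda>y. g (p(v := y))) has_real_derivative h p) (at (p v)))"
  proof (cases "v = w")
    case True
    then show ?thesis
      by (intro exI[of _ "\<lambda>_. 0"]) (use smooth_const[of 0] f(2) in auto)
  next
    case False
    then have "((\<lambda>y. g (p(v := y))) has_real_derivative pdiff v f (p(w := c))) (at (p v))"
      if "p \<in> \<Omega>" for p
      using smooth_has_pdiff[OF f(1) upd_mem[OF that c], of v] unfolding f(2)
      by (simp add: fun_upd_twist)
    then show ?thesis using smooth_pdiff[OF f(1)] by blast
  qed
qed (use assms in blast)

section \<open>Symmetry of mixed partial derivatives\<close>

text \<open>The mean value theorem is applied to the second difference over a rectangle, first in
  \<open>v\<close> and then in \<open>w\<close>.\<close>

lemma mixed_difference: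
  assumes f: "jet_smooth \<Omega> f" and p: "p \<in> \<Omega>" and "v \<noteq> w"
    and y: "y0 < y1" "{y0..y1} \<subseteq> B v" and z: "z0 < z1" "{z0..z1} \<subseteq> B w"
  obtains \<xi> \<eta> where "y0 < \<xi>" "\<xi> < y1" "z0 < \<eta>" "\<eta> < z1"
    "f (p(v := y1, w := z1)) - f (p(v := y1, w := z0)) - (f (p(v := y0, w := z1)) - f (p(v := y0, w := z0)))
      = (y1 - y0) * ((z1 - z0) * pdiff w (pdiff v f) (p(v := \<xi>, w := \<eta>)))"
proof -
  have d1: "((\<lambda>y. f (p(v := y, w := z))) has_real_derivative pdiff v f (p(v := y, w := z))) (at y)"
    if "y \<in> B v" "z \<in> B w" for y z
    using smooth_has_pdiff_upd[OF f upd_mem[OF p that(2)] that(1)] \<open>v \<noteq> w\<close> by (simp add: fun_upd_twist)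
  have "\<exists>\<xi>. y0 < \<xi> \<and> \<xi> < y1 \<and>
     (f (p(v := y1, w := z1)) - f (p(v := y1, w := z0))) - (f (p(v := y0, w := z1)) - f (p(v := y0, w := z0)))
     = (y1 - y0) * (pdiff v f (p(v := \<xi>, w := z1)) - pdiff v f (p(v := \<xi>, w := z0)))"
  proof (rule MVT2[OF y(1)])
    fix x assume "y0 \<le> x" "x \<le> y1"
    then have x: "x \<in> B v" using y by auto
    have "z0 \<in> B w" "z1 \<in> B w" using z by auto
    then show "((\<lambda>x. f (p(v := x, w := z1)) - f (p(v := x, w := z0))) has_real_derivative
        pdiff v f (p(v := x, w := z1)) - pdiff v f (p(v := x, w := z0))) (at x)"
      by (intro DERIV_diff d1 x)
  qed
  then obtain \<xi> where \<xi>: "y0 < \<xi>" "\<xi> < y1"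
     "(f (p(v := y1, w := z1)) - f (p(v := y1, w := z0))) - (f (p(v := y0, w := z1)) - f (p(v := y0, w := z0)))
     = (y1 - y0) * (pdiff v f (p(v := \<xi>, w := z1)) - pdiff v f (p(v := \<xi>, w := z0)))" by blast
  have "\<xi> \<in> B v" using \<xi> y by auto
  have "\<exists>\<eta>. z0 < \<eta> \<and> \<eta> < z1 \<and> pdiff v f (p(v := \<xi>, w := z1)) - pdiff v f (p(v := \<xi>, w := z0))
     = (z1 - z0) * pdiff w (pdiff v f) (p(v := \<xi>, w := \<eta>))"
  proof (rule MVT2[OF z(1)])
    fix x assume "z0 \<le> x" "x \<le> z1"
    then have "x \<in> B w" using z by auto
    then show "((\<lambda>x. pdiff v f (p(v := \<xi>, w := x))) has_real_derivative
        pdiff w (pdiff v f) (p(v := \<xi>, w := x))) (at x)"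
      by (rule smooth_has_pdiff_upd[OF smooth_pdiff[OF f] upd_mem[OF p \<open>\<xi> \<in> B v\<close>]])
  qed
  then show ?thesis using \<xi> that by metis
qed

text \<open>Schwarz's argument: the second difference over a small square is the same in either
  order of the variables. So the two mixed derivatives agree at intermediate points that tend to
  \<open>p\<close>, and both are continuous.\<close>

lemma pdiff_commute:
  assumes f: "jet_smooth \<Omega> f" and p: "p \<in> \<Omega>"
  shows "pdiff v (pdiff w f) p = pdiff w (pdiff v f) p"
proof (cases "v = w")
  case False
  have "\<exists>\<delta>>0. \<forall>y. dist y (p v) < \<delta> \<longrightarrow> y \<in> B v" for v
    using open_B[of v] mem_B[OF p] unfolding open_dist by blast
  then obtain \<delta> where \<delta>: "\<delta> v > 0" "dist y (p v) < \<delta> v \<Longrightarrow> y \<in> B v" for v y by metis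
  define M where "M = min (\<delta> v) (\<delta> w)"
  \<comment> \<open>The shift by 2 keeps the side strictly below \<open>M\<close>, so that the
    closed squares lie in the box already for \<open>n = 0\<close>.\<close>
  define h where "h n = M / real (n + 2)" for n
  have M: "M > 0" "M \<le> \<delta> v" "M \<le> \<delta> w" using \<delta>(1) by (auto simp: M_def)
  have h: "h n > 0" "h n < \<delta> v" "h n < \<delta> w" for n
  proof -
    have "M * 1 < M * real (n + 2)" using M(1) by (intro mult_strict_left_mono) auto
    then have "h n < M" unfolding h_def by (simp add: divide_less_eq)
    then show "h n > 0" "h n < \<delta> v" "h n < \<delta> w" using M by (auto simp: h_def)
  qed
  have h0: "h \<longlonglongrightarrow> 0"
    unfolding h_def by (rule LIMSEQ_ignore_initial_segment[OF lim_const_over_n, where k = 2])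
  have "\<exists>a b a' b'. p v < a \<and> a < p v + h n \<and> p w < b \<and> b < p w + h n \<and>
        p v < a' \<and> a' < p v + h n \<and> p w < b' \<and> b' < p w + h n \<and>
        pdiff w (pdiff v f) (p(v := a, w := b)) = pdiff v (pdiff w f) (p(v := a', w := b'))" for n
  proof -
    have I: "p v < p v + h n" "{p v..p v + h n} \<subseteq> B v" "p w < p w + h n" "{p w..p w + h n} \<subseteq> B w"
      using h[of n] by (auto simp: dist_real_def intro!: \<delta>(2))
    obtain a b where 1: "p v < a" "a < p v + h n" "p w < b" "b < p w + h n"
      "f (p(v := p v + h n, w := p w + h n)) - f (p(v := p v + h n, w := p w))
        - (f (p(v := p v, w := p w + h n)) - f (p(v := p v, w := p w)))
        = h n * (h n * pdiff w (pdiff v f) (p(v := a, w := b)))"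
      using mixed_difference[OF f p False I] by auto
    obtain a' b' where 2: "p w < b'" "b' < p w + h n" "p v < a'" "a' < p v + h n"
      "f (p(w := p w + h n, v := p v + h n)) - f (p(w := p w + h n, v := p v))
        - (f (p(w := p w, v := p v + h n)) - f (p(w := p w, v := p v)))
        = h n * (h n * pdiff v (pdiff w f) (p(w := b', v := a')))"
      using mixed_difference[OF f p False[symmetric] I(3,4,1,2)] by auto
    have "h n * (h n * pdiff w (pdiff v f) (p(v := a, w := b)))
        = h n * (h n * pdiff v (pdiff w f) (p(v := a', w := b')))"
      using 1(5) 2(5) unfolding fun_upd_twist[OF False[symmetric]] by linarith
    then show ?thesis using 1 2 h(1)[of n] by (intro exI[of _ a] exI[of _ b] exI[of _ a'] exI[of _ b']) auto
  qed
  then obtain a b a' b' where ab: "p v < a n" "a n < p v + h n" "p w < b n" "b n < p w + h n"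
      "p v < a' n" "a' n < p v + h n" "p w < b' n" "b' n < p w + h n"
      "pdiff w (pdiff v f) (p(v := a n, w := b n)) = pdiff v (pdiff w f) (p(v := a' n, w := b' n))" for n
    by metis
  have lim: "(\<lambda>n. g (p(v := x n, w := y n))) \<longlonglongrightarrow> g p"
    if g: "jet_smooth \<Omega> g" and x: "\<And>n. p v < x n" "\<And>n. x n < p v + h n"
      and y: "\<And>n. p w < y n" "\<And>n. y n < p w + h n" for g x y
  proof -
    have xl: "x \<longlonglongrightarrow> p v"
      by (rule tendsto_sandwich[OF _ _ tendsto_const[of "p v"] tendsto_add[OF tendsto_const h0, of "p v", simplified]])
         (use x in \<open>auto intro!: always_eventually less_imp_le\<close>)
    have yl: "y \<longlonglongrightarrow> p w"
      by (rule tendsto_sandwich[OF _ _ tendsto_const[of "p w"] tendsto_add[OF tendsto_const h0, of "p w", simplified]])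
         (use y in \<open>auto intro!: always_eventually less_imp_le\<close>)
    have "continuous_on (B v \<times> B w) (\<lambda>t. p(v := fst t, w := snd t))"
    proof (rule continuous_on_coordinatewise_then_product)
      show "continuous_on (B v \<times> B w) (\<lambda>t. (p(v := fst t, w := snd t)) i)" for i
        by (cases "i = w"; cases "i = v") (auto intro!: continuous_intros)
    qed
    then have c: "continuous_on (B v \<times> B w) (\<lambda>t. g (p(v := fst t, w := snd t)))"
      by (rule continuous_on_compose2[OF smooth_continuous[OF g]]) (auto intro!: upd_mem p)
    have l: "((\<lambda>n. (x n, y n)) \<longlongrightarrow> (p v, p w)) sequentially"
      by (intro tendsto_Pair xl yl)
    have "(x n, y n) \<in> B v \<times> B w" for n
    proof -
      have "dist (x n) (p v) < \<delta> v" "dist (y n) (p w) < \<delta> w"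
        using x[of n] y[of n] h[of n] by (auto simp: dist_real_def)
      then show ?thesis using \<delta>(2) by auto
    qed
    then have "\<forall>\<^sub>F n in sequentially. (x n, y n) \<in> B v \<times> B w" by simp
    then show ?thesis
      using continuous_on_tendsto_compose[OF c l] mem_B[OF p] by simp
  qed
  have "(\<lambda>n. pdiff w (pdiff v f) (p(v := a n, w := b n))) \<longlonglongrightarrow> pdiff w (pdiff v f) p"
    by (rule lim[where x = a and y = b]) (use f ab smooth_pdiff in auto)
  moreover have "(\<lambda>n. pdiff w (pdiff v f) (p(v := a n, w := b n))) \<longlonglongrightarrow> pdiff v (pdiff w f) p"
    unfolding ab(9) by (rule lim[where x = a' and y = b']) (use f ab smooth_pdiff in auto)
  ultimately show ?thesis by (rule LIMSEQ_unique[symmetric])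
qed simp

section \<open>Dependence on coordinates and vanishing derivatives\<close>

lemma depends_mono: "depends_only_on \<Omega> V f \<Longrightarrow> V \<subseteq> W \<Longrightarrow> depends_only_on \<Omega> W f"
  unfolding depends_only_on_def by blast

lemma depends_pdiff_zero:
  assumes "depends_only_on \<Omega> V f" "v \<notin> V" "p \<in> \<Omega>"
  shows "pdiff v f p = 0"
proof -
  have "pdiff v f p = pdiff v (\<lambda>_. f p) p"
  proof (rule pdiff_cong_ev)
    show "\<forall>\<^sub>F y in nhds (p v). f (p(v := y)) = f p"
      using eventually_B[OF assms(3)]
    proof (rule eventually_mono)
      fix y assume y: "y \<in> B v"
      have "\<forall>w\<in>V. (p(v := y)) w = p w" using assms(2) by auto
      then show "f (p(v := y)) = f p"
        using assms(1,3) upd_mem[OF assms(3) y] unfolding depends_only_on_def by blast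
    qed
  qed simp
  then show ?thesis by (simp add: pdiff_def)
qed

lemma depends_pdiff:
  assumes "depends_only_on \<Omega> V f" shows "depends_only_on \<Omega> V (pdiff v f)"
  unfolding depends_only_on_def
proof (intro ballI impI)
  fix p q assume pq: "p \<in> \<Omega>" "q \<in> \<Omega>" "\<forall>v\<in>V. p v = q v"
  show "pdiff v f p = pdiff v f q"
  proof (cases "v \<in> V")
    case True
    show ?thesis
    proof (rule pdiff_cong_ev)
      show "p v = q v" using pq True by blast
      show "\<forall>\<^sub>F y in nhds (p v). f (p(v := y)) = f (q(v := y))"
        using eventually_B[OF pq(1)]
      proof (rule eventually_mono)
        fix y assume y: "y \<in> B v"
        show "f (p(v := y)) = f (q(v := y))"
        proof -
          have "\<forall>w\<in>V. (p(v := y)) w = (q(v := y)) w" using pq(3) by auto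
          then show ?thesis
            using assms upd_mem[OF pq(1) y] upd_mem[OF pq(2) y] unfolding depends_only_on_def by blast
        qed
      qed
    qed
  next
    case False
    then show ?thesis using depends_pdiff_zero[OF assms] pq by simp
  qed
qed

text \<open>The coordinates in \<open>W\<close> are changed one at a time. Each change moves along
  an interval inside the box, where a zero derivative forces the function to be constant.\<close>

lemma pdiff_zero_depends:
  assumes f: "jet_smooth \<Omega> f" and "finite W" and "depends_only_on \<Omega> (V \<union> W) f"
    and "\<And>w q. w \<in> W \<Longrightarrow> q \<in> \<Omega> \<Longrightarrow> pdiff w f q = 0"
  shows "depends_only_on \<Omega> V f"
  using assms(2-)
proof (induction W rule: finite_induct)
  case (insert w W)
  have "depends_only_on \<Omega> (V \<union> W) f"
    unfolding depends_only_on_def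
  proof (intro ballI impI)
    fix p q assume pq: "p \<in> \<Omega>" "q \<in> \<Omega>" "\<forall>v\<in>V \<union> W. p v = q v"
    have "\<exists>c. \<forall>y\<in>B w. f (p(w := y)) = c"
    proof (rule has_field_derivative_zero_constant)
      show "convex (B w)" using interval_B is_interval_convex by blast
      show "((\<lambda>y. f (p(w := y))) has_field_derivative 0) (at y within B w)" if y: "y \<in> B w" for y
        using smooth_has_pdiff_upd[OF f pq(1) y] insert.prems(2)[of w] upd_mem[OF pq(1) y]
        by (simp add: has_field_derivative_at_within)
    qed
    then obtain c where "\<forall>y\<in>B w. f (p(w := y)) = c" by blast
    then have "f (p(w := p w)) = c" "f (p(w := q w)) = c" using mem_B pq by blast+
    then have "f (p(w := p w)) = f (p(w := q w))" by simp
    also have "\<dots> = f q"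
    proof -
      have "\<forall>v\<in>V \<union> insert w W. (p(w := q w)) v = q v" using pq(3) by auto
      then show ?thesis
        using insert.prems(1) upd_mem[OF pq(1) mem_B[OF pq(2)], of w] pq(2)
        unfolding depends_only_on_def by blast
    qed
    finally show "f p = f q" by simp
  qed
  then show ?case using insert by blast
qed simp

text \<open>Taylor's formula with Lagrange remainder along the \<open>v\<close> line, which stays in
  the box; the remainder is a value of the vanishing derivative. The case \<open>p v = c\<close> is
  separate, as the formula needs two distinct points.\<close>

lemma taylor_polynomial:
  assumes h: "jet_smooth \<Omega> h" and p: "p \<in> \<Omega>" and c: "c \<in> B v"
    and 0: "\<And>q. q \<in> \<Omega> \<Longrightarrow> (pdiff v ^^ Suc s) h q = 0"
  shows "h p = (\<Sum>i\<le>s. (p v - c) ^ i / fact i * (pdiff v ^^ i) h (p(v := c)))"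
proof (cases "p v = c")
  case True
  then have "p(v := c) = p" by auto
  then show ?thesis using True by (simp add: sum.atMost_shift)
next
  case False
  have sm: "jet_smooth \<Omega> ((pdiff v ^^ i) h)" for i
    by (induction i) (auto intro: h smooth_pdiff)
  have I: "t \<in> B v" if "min c (p v) \<le> t" "t \<le> max c (p v)" for t
    using interval_B[of v] c mem_B[OF p, of v] that unfolding is_interval_1 by (metis max_def min_def)
  define d where "d m t = (pdiff v ^^ m) h (p(v := t))" for m t
  have "\<exists>t. (if p v < c then p v < t \<and> t < c else c < t \<and> t < p v) \<and>
     d 0 (p v) = (\<Sum>m<Suc s. (d m c / fact m) * (p v - c) ^ m) + (d (Suc s) t / fact (Suc s)) * (p v - c) ^ Suc s"
  proof (rule Taylor[where a = "min c (p v)" and b = "max c (p v)"])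
    show "\<forall>m t. m < Suc s \<and> min c (p v) \<le> t \<and> t \<le> max c (p v) \<longrightarrow> DERIV (d m) t :> d (Suc m) t"
    proof (intro allI impI)
      fix m t assume "m < Suc s \<and> min c (p v) \<le> t \<and> t \<le> max c (p v)"
      then have "t \<in> B v" using I by blast
      then show "DERIV (d m) t :> d (Suc m) t"
        unfolding d_def using smooth_has_pdiff_upd[OF sm p, of t v m] by simp
    qed
  qed (use False in auto)
  then obtain t where t: "if p v < c then p v < t \<and> t < c else c < t \<and> t < p v"
    "d 0 (p v) = (\<Sum>m<Suc s. (d m c / fact m) * (p v - c) ^ m) + (d (Suc s) t / fact (Suc s)) * (p v - c) ^ Suc s"
    by blast
  have "t \<in> B v" by (rule I) (use t(1) in \<open>auto split: if_splits\<close>)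
  then have "d (Suc s) t = 0" using 0 upd_mem[OF p] unfolding d_def by blast
  then have "h p = (\<Sum>m<Suc s. (d m c / fact m) * (p v - c) ^ m)"
    using t(2) by (simp add: d_def)
  then show ?thesis
    unfolding lessThan_Suc_atMost d_def by (simp add: mult.commute)
qed

section \<open>The algebra of smooth jet functions on the domain\<close>

definition cut :: "(jet \<Rightarrow> real) \<Rightarrow> jet \<Rightarrow> real" where
  "cut f p = (if p \<in> \<Omega> then f p else 0)"

definition smooth_jets :: "(jet \<Rightarrow> real) set" where
  "smooth_jets = {f. jet_smooth \<Omega> f \<and> (\<exists>m. depends_only_on \<Omega> ({VarX, VarT} \<union> VarU ` {..<m}) f) \<and> (\<forall>p. p \<notin> \<Omega> \<longrightarrow> f p = 0)}"

text \<open>The result is cut again because off \<open>\<Omega>\<close>, for instance on its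
  boundary, the derivative of a function extended by zero is not controlled.\<close>

definition jet_partial :: "jet_var \<Rightarrow> (jet \<Rightarrow> real) \<Rightarrow> jet \<Rightarrow> real" where
  "jet_partial v f = cut (pdiff v f)"

lemma cut_mem [simp]: "p \<in> \<Omega> \<Longrightarrow> cut f p = f p"
  by (simp add: cut_def)

lemma smooth_jets_I:
  "jet_smooth \<Omega> f \<Longrightarrow> depends_only_on \<Omega> ({VarX, VarT} \<union> VarU ` {..<m}) f \<Longrightarrow> (\<And>p. p \<notin> \<Omega> \<Longrightarrow> f p = 0) \<Longrightarrow> f \<in> smooth_jets"
  unfolding smooth_jets_def by blast

lemma cut_smooth_jets:
  assumes "jet_smooth \<Omega> f" "depends_only_on \<Omega> ({VarX, VarT} \<union> VarU ` {..<m}) f"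
  shows "cut f \<in> smooth_jets"
proof (rule smooth_jets_I)
  show "jet_smooth \<Omega> (cut f)" by (rule smooth_cong[OF assms(1)]) simp
  show "depends_only_on \<Omega> ({VarX, VarT} \<union> VarU ` {..<m}) (cut f)"
    using assms(2) unfolding depends_only_on_def by (metis cut_mem)
qed (simp add: cut_def)

lemma smooth_jets_smooth: "f \<in> smooth_jets \<Longrightarrow> jet_smooth \<Omega> f"
  by (simp add: smooth_jets_def)

lemma smooth_jets_outside: "f \<in> smooth_jets \<Longrightarrow> p \<notin> \<Omega> \<Longrightarrow> f p = 0"
  by (simp add: smooth_jets_def)

lemma smooth_jets_depends2:
  assumes "f \<in> smooth_jets" "g \<in> smooth_jets"
  obtains m where "depends_only_on \<Omega> ({VarX, VarT} \<union> VarU ` {..<m}) f"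
    "depends_only_on \<Omega> ({VarX, VarT} \<union> VarU ` {..<m}) g"
proof -
  obtain k l where *: "depends_only_on \<Omega> ({VarX, VarT} \<union> VarU ` {..<k}) f"
    "depends_only_on \<Omega> ({VarX, VarT} \<union> VarU ` {..<l}) g"
    using assms by (auto simp: smooth_jets_def)
  show ?thesis
    by (rule that[of "max k l"]) (rule depends_mono[OF *(1)] depends_mono[OF *(2)]; auto)+
qed

lemma smooth_jets_eqI: "f \<in> smooth_jets \<Longrightarrow> g \<in> smooth_jets \<Longrightarrow> (\<And>p. p \<in> \<Omega> \<Longrightarrow> f p = g p) \<Longrightarrow> f = g"
  by (rule ext) (metis smooth_jets_outside)

lemma smooth_jets_add: assumes "f \<in> smooth_jets" "g \<in> smooth_jets" shows "f + g \<in> smooth_jets"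
proof -
  obtain m where "depends_only_on \<Omega> ({VarX, VarT} \<union> VarU ` {..<m}) f"
    "depends_only_on \<Omega> ({VarX, VarT} \<union> VarU ` {..<m}) g" using smooth_jets_depends2[OF assms] .
  then have "depends_only_on \<Omega> ({VarX, VarT} \<union> VarU ` {..<m}) (f + g)"
    unfolding depends_only_on_def plus_fun_apply by metis
  then show ?thesis
    using smooth_add[OF smooth_jets_smooth[OF assms(1)] smooth_jets_smooth[OF assms(2)]] assms
    by (intro smooth_jets_I) (auto simp: plus_fun_def smooth_jets_outside)
qed

lemma smooth_jets_mult: assumes "f \<in> smooth_jets" "g \<in> smooth_jets" shows "f * g \<in> smooth_jets"
proof -
  obtain m where "depends_only_on \<Omega> ({VarX, VarT} \<union> VarU ` {..<m}) f"
    "depends_only_on \<Omega> ({VarX, VarT} \<union> VarU ` {..<m}) g" using smooth_jets_depends2[OF assms] .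
  then have "depends_only_on \<Omega> ({VarX, VarT} \<union> VarU ` {..<m}) (f * g)"
    unfolding depends_only_on_def times_fun_apply by metis
  then show ?thesis
    using smooth_mult[OF smooth_jets_smooth[OF assms(1)] smooth_jets_smooth[OF assms(2)]] assms
    by (intro smooth_jets_I) (auto simp: times_fun_def smooth_jets_outside)
qed

lemma smooth_jets_uminus: assumes "f \<in> smooth_jets" shows "- f \<in> smooth_jets"
proof -
  obtain m where "depends_only_on \<Omega> ({VarX, VarT} \<union> VarU ` {..<m}) f" using smooth_jets_depends2[OF assms assms] .
  then have "depends_only_on \<Omega> ({VarX, VarT} \<union> VarU ` {..<m}) (- f)"
    unfolding depends_only_on_def minus_fun_app by metis
  then show ?thesis
    using smooth_uminus[OF smooth_jets_smooth[OF assms]] assms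
    by (intro smooth_jets_I) (auto simp: fun_Compl_def smooth_jets_outside)
qed

lemma jet_partial_smooth_jets: assumes "f \<in> smooth_jets" shows "jet_partial v f \<in> smooth_jets"
proof -
  obtain m where "depends_only_on \<Omega> ({VarX, VarT} \<union> VarU ` {..<m}) f" using smooth_jets_depends2[OF assms assms] .
  then show ?thesis unfolding jet_partial_def using depends_pdiff smooth_pdiff smooth_jets_smooth[OF assms] by (blast intro: cut_smooth_jets)
qed

lemma jet_partial_has_derivative:
  "f \<in> smooth_jets \<Longrightarrow> p \<in> \<Omega> \<Longrightarrow> ((\<lambda>y. f (p(v := y))) has_real_derivative jet_partial v f p) (at (p v))"
  using smooth_has_pdiff[OF smooth_jets_smooth] by (simp add: jet_partial_def)

lemma jet_partial_eqI:
  assumes "((\<lambda>y. f (p(v := y))) has_real_derivative d) (at (p v))" "p \<in> \<Omega>"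
  shows "jet_partial v f p = d"
  using DERIV_imp_deriv[OF assms(1)] assms(2) by (simp add: jet_partial_def pdiff_def)

lemma jet_partial_outside: "p \<notin> \<Omega> \<Longrightarrow> jet_partial v f p = 0"
  by (simp add: jet_partial_def cut_def)

abbreviation "one_jet \<equiv> cut (\<lambda>_. 1)"
abbreviation "u_jet i \<equiv> cut (\<lambda>p. p (VarU i))"

lemma smooth_jets_finite: assumes "f \<in> smooth_jets" shows "\<exists>m. \<forall>i\<ge>m. jet_partial (VarU i) f = 0"
proof -
  obtain m where m: "depends_only_on \<Omega> ({VarX, VarT} \<union> VarU ` {..<m}) f" using smooth_jets_depends2[OF assms assms] .
  have "jet_partial (VarU i) f p = 0" if "i \<ge> m" for i p
    using depends_pdiff_zero[OF m, of "VarU i" p] that by (auto simp: jet_partial_def cut_def image_iff)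
  then show ?thesis by (auto simp: fun_eq_iff)
qed

lemma one_smooth_jets: "one_jet \<in> smooth_jets"
  by (rule cut_smooth_jets[OF smooth_const, of 0]) (auto simp: depends_only_on_def)

lemma u_smooth_jets: "u_jet i \<in> smooth_jets"
  by (rule cut_smooth_jets[OF smooth_coord, of "Suc i"]) (auto simp: depends_only_on_def)

lemma jet_partial_u: "jet_partial v (u_jet i) = (if v = VarU i then one_jet else 0)"
proof
  fix p
  show "jet_partial v (u_jet i) p = (if v = VarU i then one_jet else 0) p"
  proof (cases "p \<in> \<Omega>")
    case True
    have "pdiff v (u_jet i) p = pdiff v (\<lambda>p. p (VarU i)) p"
      by (rule pdiff_cong[OF _ True]) simp
    also have "\<dots> = (if v = VarU i then 1 else 0)"
      by (auto simp: pdiff_def)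
    finally show ?thesis using True by (simp add: jet_partial_def)
  qed (simp add: jet_partial_outside cut_def)
qed

text \<open>The ambient ring consists of all real functions on jets with pointwise operations. The
  laws for derivatives are checked on \<open>\<Omega>\<close> only, and the absence of torsion and
  nilpotents is inherited from the reals.\<close>

sublocale J: jet_algebra smooth_jets jet_partial one_jet u_jet
proof
  fix a b :: "jet \<Rightarrow> real" and v w :: jet_var and i n :: nat
  show "a \<in> smooth_jets \<Longrightarrow> b \<in> smooth_jets \<Longrightarrow> a + b \<in> smooth_jets" by (rule smooth_jets_add)
  show "a \<in> smooth_jets \<Longrightarrow> b \<in> smooth_jets \<Longrightarrow> a * b \<in> smooth_jets" by (rule smooth_jets_mult)
  show "a \<in> smooth_jets \<Longrightarrow> - a \<in> smooth_jets" by (rule smooth_jets_uminus)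
  show "one_jet \<in> smooth_jets" by (rule one_smooth_jets)
  show "u_jet i \<in> smooth_jets" by (rule u_smooth_jets)
  show "a \<in> smooth_jets \<Longrightarrow> jet_partial v a \<in> smooth_jets" by (rule jet_partial_smooth_jets)
  show "a \<in> smooth_jets \<Longrightarrow> one_jet * a = a" by (rule ext) (auto simp: cut_def smooth_jets_outside)
  show "jet_partial v (a + b) = jet_partial v a + jet_partial v b" if "a \<in> smooth_jets" "b \<in> smooth_jets"
  proof (rule smooth_jets_eqI)
    fix p assume p: "p \<in> \<Omega>"
    show "jet_partial v (a + b) p = (jet_partial v a + jet_partial v b) p"
      by (rule jet_partial_eqI[OF _ p])
         (use DERIV_add[OF jet_partial_has_derivative[OF that(1) p] jet_partial_has_derivative[OF that(2) p]] in simp)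
  qed (intro smooth_jets_add jet_partial_smooth_jets that)+
  show "jet_partial v (a * b) = jet_partial v a * b + a * jet_partial v b" if "a \<in> smooth_jets" "b \<in> smooth_jets"
  proof (rule smooth_jets_eqI)
    fix p assume p: "p \<in> \<Omega>"
    show "jet_partial v (a * b) p = (jet_partial v a * b + a * jet_partial v b) p"
      by (rule jet_partial_eqI[OF _ p])
         (use DERIV_mult[OF jet_partial_has_derivative[OF that(1) p] jet_partial_has_derivative[OF that(2) p]] in \<open>simp add: mult_ac\<close>)
  qed (intro smooth_jets_add smooth_jets_mult jet_partial_smooth_jets that)+
  show "jet_partial v (jet_partial w a) = jet_partial w (jet_partial v a)" if a: "a \<in> smooth_jets"
  proof (rule smooth_jets_eqI)
    fix p assume p: "p \<in> \<Omega>"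
    have "jet_partial v (jet_partial w a) p = pdiff v (pdiff w a) p" for v w
      using p by (auto simp: jet_partial_def intro: pdiff_cong)
    then show "jet_partial v (jet_partial w a) p = jet_partial w (jet_partial v a) p"
      using pdiff_commute[OF smooth_jets_smooth[OF a] p, of v w] by simp
  qed (intro jet_partial_smooth_jets a)+
  show "jet_partial v (u_jet i) = (if v = VarU i then one_jet else 0)" by (rule jet_partial_u)
  show "a \<in> smooth_jets \<Longrightarrow> \<exists>m. \<forall>i\<ge>m. jet_partial (VarU i) a = 0" by (rule smooth_jets_finite)
  show "a = 0" if "a \<in> smooth_jets" "of_nat (Suc n) * a = 0"
  proof
    fix p
    show "a p = 0 p" using fun_cong[OF that(2), of p] by (simp del: of_nat_Suc)
  qed
  show "a = 0" if "a \<in> smooth_jets" "a * a = 0"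
  proof
    fix p
    show "a p = 0 p" using fun_cong[OF that(2), of p] by simp
  qed
qed

section \<open>Total derivative, linearization and order within the algebra\<close>

lemma sum_fun_apply: "sum f I (p::jet) = (\<Sum>i\<in>I. f i p :: real)"
  by (induction I rule: infinite_finite_induct) auto

text \<open>The series is finite because the partial derivatives of \<open>f\<close> vanish from
  some index on. Only agreement on \<open>\<Omega>\<close> is asked of \<open>g\<close>, so that the
  lemma can be iterated.\<close>

lemma total_deriv_eq_D:
  assumes "f \<in> smooth_jets" "p \<in> \<Omega>" "\<And>q. q \<in> \<Omega> \<Longrightarrow> g q = f q"
  shows "total_deriv g p = J.D f p"
proof -
  have eq: "pdiff v g p = jet_partial v f p" for v
    using assms by (auto simp: jet_partial_def intro: pdiff_cong)
  obtain m where m: "J.ubound m f" using J.ex_ubound[OF assms(1)] by blast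
  have "(\<Sum>i. p (VarU (Suc i)) * pdiff (VarU i) g p) = (\<Sum>i<m. p (VarU (Suc i)) * pdiff (VarU i) g p)"
    by (rule suminf_finite) (use m in \<open>auto simp: eq J.ubound_def\<close>)
  then show ?thesis
    unfolding total_deriv_def J.D_eq[OF m] using assms(2) by (simp add: eq sum_fun_apply)
qed

lemma total_deriv_pow_eq:
  assumes "f \<in> smooth_jets" "p \<in> \<Omega>" "\<And>q. q \<in> \<Omega> \<Longrightarrow> g q = f q"
  shows "(total_deriv ^^ i) g p = (J.D ^^ i) f p"
  using assms(2)
proof (induction i arbitrary: p)
  case (Suc i)
  show ?case
    unfolding funpow.simps comp_def
    by (rule total_deriv_eq_D) (use assms Suc in auto)
qed (use assms in simp)

lemma frechet_eq_Fr:
  assumes "h \<in> smooth_jets" "r \<in> smooth_jets" "p \<in> \<Omega>" "\<And>q. q \<in> \<Omega> \<Longrightarrow> h' q = h q" "\<And>q. q \<in> \<Omega> \<Longrightarrow> r' q = r q"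
  shows "frechet h' r' p = J.Fr h r p"
proof -
  have eq: "pdiff v h' p = jet_partial v h p" for v
    using assms by (auto simp: jet_partial_def intro: pdiff_cong)
  obtain m where m: "J.ubound m h" using J.ex_ubound[OF assms(1)] by blast
  have "frechet h' r' p = (\<Sum>i<m. pdiff (VarU i) h' p * (total_deriv ^^ i) r' p)"
    unfolding frechet_def by (rule suminf_finite) (use m in \<open>auto simp: eq J.ubound_def\<close>)
  also have "\<dots> = J.Fr h r p"
    unfolding J.Fr_eq[OF m]
    using total_deriv_pow_eq[OF assms(2,3,5)] by (simp add: eq sum_fun_apply)
  finally show ?thesis .
qed

lemma ubound_depends:
  assumes f: "f \<in> smooth_jets" and "J.ubound m f"
  shows "depends_only_on \<Omega> ({VarX, VarT} \<union> VarU ` {..<m}) f"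
proof -
  obtain l where l: "depends_only_on \<Omega> ({VarX, VarT} \<union> VarU ` {..<l}) f" using smooth_jets_depends2[OF f f] .
  show ?thesis
  proof (rule pdiff_zero_depends[OF smooth_jets_smooth[OF f], of "VarU ` {m..<l}"])
    show "depends_only_on \<Omega> ({VarX, VarT} \<union> VarU ` {..<m} \<union> VarU ` {m..<l}) f"
      by (rule depends_mono[OF l]) (auto simp: image_iff not_less)
    fix w q assume "w \<in> VarU ` {m..<l}" and q: "q \<in> \<Omega>"
    then obtain i where "w = VarU i" "i \<ge> m" by auto
    then have "jet_partial w f = 0" using J.uboundD[OF assms(2)] by blast
    then show "pdiff w f q = 0" using q unfolding jet_partial_def by (metis cut_mem zero_fun_apply)
  qed simp
qed

lemma jet_order_ubound:
  assumes G: "cut G \<in> smooth_jets" shows "J.ubound (Suc (jet_order \<Omega> G)) (cut G)"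
proof -
  define I where "I = {i. \<exists>p\<in>\<Omega>. pdiff (VarU i) G p \<noteq> 0}"
  have eq: "jet_partial (VarU i) (cut G) p = (if p \<in> \<Omega> then pdiff (VarU i) G p else 0)" for i p
    by (auto simp: jet_partial_def cut_def intro: pdiff_cong)
  obtain m where m: "J.ubound m (cut G)" using J.ex_ubound[OF G] by blast
  have "i < m" if iI: "i \<in> I" for i
  proof (rule ccontr)
    assume "\<not> i < m"
    then have "jet_partial (VarU i) (cut G) = 0" using J.uboundD[OF m] by simp
    moreover obtain p where "p \<in> \<Omega>" "pdiff (VarU i) G p \<noteq> 0" using iI by (auto simp: I_def)
    ultimately show False using eq[of i p] by simp
  qed
  \<comment> \<open>Without finiteness \<open>Max I\<close> would not bound
    \<open>I\<close>.\<close>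
  then have "finite I" by (meson finite_nat_iff_bounded lessThan_iff subsetI)
  have "i \<notin> I" if "i \<ge> Suc (jet_order \<Omega> G)" for i
  proof
    assume "i \<in> I"
    then have "jet_order \<Omega> G = Max I" unfolding jet_order_def I_def[symmetric] by (auto simp: Let_def)
    then show False using that Max_ge[OF \<open>finite I\<close> \<open>i \<in> I\<close>] by simp
  qed
  then show ?thesis
    unfolding J.ubound_def by (auto simp: fun_eq_iff eq I_def)
qed

lemma depends_ubound:
  assumes "depends_only_on \<Omega> V f" "\<And>i. i \<ge> m \<Longrightarrow> VarU i \<notin> V"
  shows "J.ubound m (cut f)"
proof -
  have "pdiff v (cut f) p = pdiff v f p" if "p \<in> \<Omega>" for v p
    by (rule pdiff_cong[OF _ that]) simp
  then show ?thesis
    using depends_pdiff_zero[OF assms(1) assms(2)]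
    by (auto simp: J.ubound_def fun_eq_iff jet_partial_def cut_def)
qed

lemma jet_partial_pow_eq:
  assumes "f \<in> smooth_jets" "q \<in> \<Omega>" shows "(pdiff v ^^ l) f q = (jet_partial v ^^ l) f q"
  using assms(2)
proof (induction l arbitrary: q)
  case (Suc l)
  have "pdiff v ((pdiff v ^^ l) f) q = pdiff v ((jet_partial v ^^ l) f) q"
    by (rule pdiff_cong) (use Suc in auto)
  then show ?case using Suc.prems by (simp add: jet_partial_def[of v "(jet_partial v ^^ l) f"])
qed simp

lemma jet_partial_pow_commute: "f \<in> smooth_jets \<Longrightarrow> (jet_partial VarX ^^ l) (jet_partial w f) = jet_partial w ((jet_partial VarX ^^ l) f)"
  by (induction l) (auto simp: J.P_commute[of _ VarX w])

end

section \<open>The structure of symmetries\<close>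

text \<open>Expanding each power of \<open>x - c\<close> by the binomial theorem and exchanging the
  sums collects the coefficient of \<open>x ^ j\<close>. This passes from an expansion at a point of
  the domain to powers of x itself.\<close>

lemma shifted_polynomial:
  fixes A :: "nat \<Rightarrow> real"
  shows "(\<Sum>j=0..s. x ^ j * (\<Sum>i=j..s. (- c) ^ (i - j) / (fact j * fact (i - j)) * A i))
       = (\<Sum>i\<le>s. (x - c) ^ i / fact i * A i)"
proof -
  have "(\<Sum>j=0..s. x ^ j * (\<Sum>i=j..s. (- c) ^ (i - j) / (fact j * fact (i - j)) * A i))
      = (\<Sum>j\<in>{0..s}. \<Sum>i | i \<in> {..s} \<and> j \<le> i. x ^ j * ((- c) ^ (i - j) / (fact j * fact (i - j)) * A i))"
    by (auto simp: sum_distrib_left intro!: sum.cong)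
  also have "\<dots> = (\<Sum>i\<in>{..s}. \<Sum>j | j \<in> {0..s} \<and> j \<le> i. x ^ j * ((- c) ^ (i - j) / (fact j * fact (i - j)) * A i))"
    by (rule sum.swap_restrict) auto
  also have "\<dots> = (\<Sum>i\<le>s. (\<Sum>j\<le>i. of_nat (i choose j) * x ^ j * (- c) ^ (i - j)) / fact i * A i)"
  proof (intro sum.cong refl)
    fix i assume "i \<in> {..s}"
    then have "{j. j \<in> {0..s} \<and> j \<le> i} = {..i}" by auto
    then show "(\<Sum>j | j \<in> {0..s} \<and> j \<le> i. x ^ j * ((- c) ^ (i - j) / (fact j * fact (i - j)) * A i))
        = (\<Sum>j\<le>i. of_nat (i choose j) * x ^ j * (- c) ^ (i - j)) / fact i * A i"
      by (auto simp: sum_divide_distrib sum_distrib_right binomial_fact intro!: sum.cong)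
  qed
  also have "\<dots> = (\<Sum>i\<le>s. (x - c) ^ i / fact i * A i)"
    using binomial_ring[of x "- c"] by simp
  finally show ?thesis .
qed

text \<open>If \<open>k\<close> leaves residue 0 or 1 modulo \<open>n - 1\<close>, subtracting 2
  crosses a multiple of \<open>n - 1\<close> and lowers the quotient; this is where the two cases of
  \<open>r_bound\<close> come from. For \<open>k < 2\<close> the left side is 0.\<close>

lemma le_r_bound: assumes "n \<ge> 2" shows "(k - 2) div (n - 1) \<le> r_bound k n"
proof (cases "k \<ge> 2 \<and> ([k = 0] (mod (n - 1)) \<or> [k = 1] (mod (n - 1)))")
  case True
  have "k mod (n - 1) \<le> 1" using True by (auto simp: cong_def)
  then have "k - 2 < k div (n - 1) * (n - 1)"
    using True div_mult_mod_eq[of k "n - 1"] by linarith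
  then have "(k - 2) div (n - 1) < k div (n - 1)" by (rule less_mult_imp_div_less)
  then show ?thesis using True by (simp add: r_bound_def)
next
  case False
  then show ?thesis using assms by (auto simp: r_bound_def div_le_mono not_le)
qed

section \<open>Taylor expansion of a symmetry in x\<close>

theorem theorem1:
  fixes \<Omega> :: "jet set" and F G :: "jet \<Rightarrow> real" and n k :: nat
  assumes "n \<ge> 2"
    and "jet_domain \<Omega>"
    and "jet_function \<Omega> ({VarT} \<union> VarU ` {..n}) F"
    and "\<forall>p\<in>\<Omega>. pdiff (VarU n) F p \<noteq> 0"
    and "is_symmetry \<Omega> F G"
    and "jet_order \<Omega> G = k"
  shows "\<exists>s \<le> r_bound k n. \<exists>\<psi> g.
           jet_function \<Omega> {VarT, VarX, VarU 0, VarU 1} \<psi> \<and>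
           (\<forall>j\<le>s. jet_function \<Omega> ({VarT} \<union> VarU ` {..k - j * (n - 1)}) (g j)) \<and>
           (\<forall>p\<in>\<Omega>. G p = \<psi> p + (\<Sum>j=0..s. p VarX ^ j * g j p))"
proof -
  obtain B where "(\<forall>v. open (B v) \<and> is_interval (B v) \<and> B v \<noteq> {}) \<and> \<Omega> = {p. \<forall>v. p v \<in> B v}"
    using assms(2) unfolding jet_domain_def by (rule exE)
  then have B: "\<And>v. open (B v)" "\<And>v. is_interval (B v)" "\<And>v. B v \<noteq> {}" "\<Omega> = {p. \<forall>v. p v \<in> B v}"
    by simp_all
  interpret jet_box \<Omega> B by unfold_locales (use B in auto)
  \<comment> \<open>Base point of the Taylor expansion; 0 need not belong to the x-interval.\<close>
  obtain x0 where x0: "x0 \<in> B VarX" using B(3) by blast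
  have F: "jet_smooth \<Omega> F" "depends_only_on \<Omega> ({VarT} \<union> VarU ` {..n}) F"
    using assms(3) by (auto simp: jet_function_def)
  obtain m0 where G: "jet_smooth \<Omega> G" "depends_only_on \<Omega> ({VarX, VarT} \<union> VarU ` {..m0}) G"
    and sym: "\<And>p. p \<in> \<Omega> \<Longrightarrow> pdiff VarT G p = jet_bracket F G p"
    using assms(5) by (auto simp: is_symmetry_def jet_function_def)
  have FK: "cut F \<in> smooth_jets"
    by (rule cut_smooth_jets[OF F(1) depends_mono[OF F(2)], of "Suc n"]) auto
  have GK: "cut G \<in> smooth_jets"
    by (rule cut_smooth_jets[OF G(1) depends_mono[OF G(2)], of "Suc m0"]) auto
  have Fu: "J.ubound (Suc n) (cut F)" by (rule depends_ubound[OF F(2)]) auto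
  have Gu: "J.ubound (Suc k) (cut G)" using jet_order_ubound[OF GK] assms(6) by simp
  have jet_partial_cut: "jet_partial v (cut f) p = pdiff v f p" if "p \<in> \<Omega>" for v f p
    using that by (auto simp: jet_partial_def intro: pdiff_cong)
  have FX: "jet_partial VarX (cut F) = 0"
  proof (rule smooth_jets_eqI)
    show "jet_partial VarX (cut F) p = 0 p" if "p \<in> \<Omega>" for p
      using depends_pdiff_zero[OF F(2) _ that, of VarX] jet_partial_cut[OF that] by auto
  qed (use FK J.P_K J.zero_K in auto)
  define f' where "f' = cut (\<lambda>p. inverse (pdiff (VarU n) F p))"
  have f'K: "f' \<in> smooth_jets"
    unfolding f'_def
  proof (rule cut_smooth_jets[where m = "Suc n"])
    show "jet_smooth \<Omega> (\<lambda>p. inverse (pdiff (VarU n) F p))"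
      by (rule smooth_inverse[OF smooth_pdiff[OF F(1)]]) (use assms(4) in auto)
    have "depends_only_on \<Omega> ({VarX, VarT} \<union> VarU ` {..<Suc n}) (pdiff (VarU n) F)"
      by (rule depends_mono[OF depends_pdiff[OF F(2)]]) auto
    then show "depends_only_on \<Omega> ({VarX, VarT} \<union> VarU ` {..<Suc n}) (\<lambda>p. inverse (pdiff (VarU n) F p))"
      unfolding depends_only_on_def by metis
  qed
  have f': "jet_partial (VarU n) (cut F) * f' = one_jet"
  proof (rule smooth_jets_eqI)
    show "(jet_partial (VarU n) (cut F) * f') p = one_jet p" if "p \<in> \<Omega>" for p
      using that assms(4) jet_partial_cut[OF that] by (simp add: f'_def)
  qed (use FK f'K J.P_K J.mult_K J.e_K in auto)
  have symJ: "jet_partial VarT (cut G) = J.Fr (cut F) (cut G) - J.Fr (cut G) (cut F)"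
  proof (rule smooth_jets_eqI)
    show "jet_partial VarT (cut G) p = (J.Fr (cut F) (cut G) - J.Fr (cut G) (cut F)) p" if p: "p \<in> \<Omega>" for p
      using sym[OF p] jet_partial_cut[OF p] frechet_eq_Fr[OF FK GK p, of F G] frechet_eq_Fr[OF GK FK p, of G F]
      by (simp add: jet_bracket_def)
  qed (use FK GK J.P_K J.diff_K J.Fr_K in auto)
  define H where "H j = (jet_partial VarX ^^ j) (cut G)" for j
  have HK: "H j \<in> smooth_jets" for j unfolding H_def using GK by (rule J.PXn_K)
  have Hu: "J.ubound (max 2 (Suc (k - j * (n - 1)))) (H j)" for j
    unfolding H_def by (rule J.symmetry_PXn_ubound[OF FK Fu FX f' f'K assms(1) GK Gu symJ])
  \<comment> \<open>For \<open>k \<ge> 2\<close> this is the last \<open>j\<close> with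
    \<open>k - j * (n - 1) \<ge> 2\<close>, so from \<open>H (Suc s)\<close> on only
    \<open>u\<close> and \<open>u_1\<close> can occur. For \<open>k < 2\<close> it is 0.\<close>
  define s where "s = (k - 2) div (n - 1)"
  have Hu_le: "J.ubound (Suc (k - j * (n - 1))) (H j)" if "j \<le> s" for j
  proof (cases "k \<ge> 2")
    case True
    have "j * (n - 1) \<le> s * (n - 1)" using that by (rule mult_le_mono1)
    also have "\<dots> \<le> k - 2" unfolding s_def by (rule div_times_less_eq_dividend)
    \<comment> \<open>Up to \<open>s\<close> the order bound is still at least 2, so the maximum
      with 2 has no effect.\<close>
    finally show ?thesis using Hu[of j] True by (simp add: max_def split: if_splits)
  next
    case False
    then have "j = 0" using that by (simp add: s_def)
    then show ?thesis using Gu by (simp add: H_def)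
  qed
  have Hu_Suc: "J.ubound 2 (H (Suc s))"
  proof -
    have "k - 2 < Suc s * (n - 1)"
      unfolding s_def using dividend_less_div_times[of "n - 1" "k - 2"] assms(1) by simp
    then have "max 2 (Suc (k - Suc s * (n - 1))) = 2" by linarith
    then show ?thesis using Hu[of "Suc s"] by (simp only:)
  qed
  \<comment> \<open>The coefficient of \<open>x ^ j\<close> in the Taylor polynomial of
    \<open>G\<close> at \<open>x0\<close>, as arranged in \<open>shifted_polynomial\<close>; the
    \<open>H i\<close> are frozen at \<open>x0\<close>, which removes x.\<close>
  define g where "g j p = (\<Sum>i=j..s. (- x0) ^ (i - j) / (fact j * fact (i - j)) * H i (p(VarX := x0)))" for j p
  define \<psi> where "\<psi> p = G p - (\<Sum>j=0..s. p VarX ^ j * g j p)" for p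
  have g_smooth: "jet_smooth \<Omega> (g j)" for j
    unfolding g_def[abs_def]
    by (intro smooth_sum smooth_mult smooth_const smooth_freeze smooth_jets_smooth HK x0)
  have \<psi>_smooth: "jet_smooth \<Omega> \<psi>"
    unfolding \<psi>_def[abs_def]
    by (intro smooth_diff smooth_sum smooth_mult smooth_power smooth_coord g_smooth G)
  have g_depends: "depends_only_on \<Omega> ({VarT} \<union> VarU ` {..k - j * (n - 1)}) (g j)" for j
    unfolding depends_only_on_def
  proof (intro ballI impI)
    fix p q assume pq: "p \<in> \<Omega>" "q \<in> \<Omega>" "\<forall>v\<in>{VarT} \<union> VarU ` {..k - j * (n - 1)}. p v = q v"
    have "H i (p(VarX := x0)) = H i (q(VarX := x0))" if i: "i \<in> {j..s}" for i
    proof -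
      \<comment> \<open>Only \<open>H i\<close> with \<open>i \<ge> j\<close> enter
        \<open>g j\<close>, and their order bounds decrease with \<open>i\<close>.\<close>
      have "j * (n - 1) \<le> i * (n - 1)" using i by (intro mult_le_mono1) auto
      then have "k - i * (n - 1) \<le> k - j * (n - 1)" by (rule diff_le_mono2)
      then have "p (VarU l) = q (VarU l)" if "l < Suc (k - i * (n - 1))" for l
        using pq(3) that by (meson UnI2 atMost_iff imageI less_Suc_eq_le order_trans)
      then have "\<forall>v\<in>{VarX, VarT} \<union> VarU ` {..<Suc (k - i * (n - 1))}. (p(VarX := x0)) v = (q(VarX := x0)) v"
        using pq(3) by auto
      moreover have "depends_only_on \<Omega> ({VarX, VarT} \<union> VarU ` {..<Suc (k - i * (n - 1))}) (H i)"
        using ubound_depends[OF HK Hu_le] i by simp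
      ultimately show ?thesis
        using upd_mem[OF pq(1) x0] upd_mem[OF pq(2) x0] unfolding depends_only_on_def by blast
    qed
    then show "g j p = g j q" unfolding g_def by (intro sum.cong) auto
  qed
  have "depends_only_on \<Omega> {VarT, VarX, VarU 0, VarU 1} \<psi>"
  \<comment> \<open>A priori \<open>\<psi>\<close> involves the coordinates up to
    \<open>u_k\<close>; it remains to show that its derivatives by those from \<open>u_2\<close> on
    vanish.\<close>
  proof (rule pdiff_zero_depends[OF \<psi>_smooth, where W = "VarU ` {2..k}"])
    show "depends_only_on \<Omega> ({VarT, VarX, VarU 0, VarU 1} \<union> VarU ` {2..k}) \<psi>"
      unfolding depends_only_on_def
    proof (intro ballI impI)
      fix p q assume pq: "p \<in> \<Omega>" "q \<in> \<Omega>" "\<forall>v\<in>{VarT, VarX, VarU 0, VarU 1} \<union> VarU ` {2..k}. p v = q v"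
      have u: "p (VarU i) = q (VarU i)" if ik: "i \<le> k" for i
      proof -
        consider "i = 0" | "i = 1" | "i \<in> {2..k}" using ik by fastforce
        then show ?thesis using pq(3) by cases auto
      qed
      have "\<forall>v\<in>{VarX, VarT} \<union> VarU ` {..<Suc k}. p v = q v" using pq(3) u by auto
      then have "cut G p = cut G q"
        using ubound_depends[OF GK Gu] pq(1,2) unfolding depends_only_on_def by blast
      moreover have "g j p = g j q" for j
      proof -
        have "\<forall>v\<in>{VarT} \<union> VarU ` {..k - j * (n - 1)}. p v = q v" using pq(3) u by auto
        then show ?thesis using g_depends[of j] pq(1,2) unfolding depends_only_on_def by blast
      qed
      ultimately show "\<psi> p = \<psi> q" using pq unfolding \<psi>_def by simp
    qed
    fix w p assume "w \<in> VarU ` {2..k}" and p: "p \<in> \<Omega>"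
    then obtain i where w: "w = VarU i" and i: "i \<ge> 2" by auto
    have H_pdiff: "(pdiff VarX ^^ l) (jet_partial w (cut G)) q = jet_partial w (H l) q" if "q \<in> \<Omega>" for l q
      using jet_partial_pow_eq[OF J.P_K[OF GK] that] jet_partial_pow_commute[OF GK] by (simp add: H_def)
    \<comment> \<open>The derivative of \<open>G\<close> by \<open>u_i\<close> with
      \<open>i \<ge> 2\<close> is a polynomial in x of degree at most \<open>s\<close>: its
      x-derivative of order \<open>Suc s\<close> is the derivative of \<open>H (Suc s)\<close> by
      \<open>u_i\<close>, which is zero. So the Taylor polynomial reproduces it exactly.\<close>
    have taylor: "jet_partial w (cut G) p = (\<Sum>l\<le>s. (p VarX - x0) ^ l / fact l * jet_partial w (H l) (p(VarX := x0)))"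
    proof -
      have "(pdiff VarX ^^ Suc s) (jet_partial w (cut G)) q = 0" if "q \<in> \<Omega>" for q
        unfolding H_pdiff[OF that] using J.uboundD[OF Hu_Suc i] by (simp add: w)
      from taylor_polynomial[OF smooth_jets_smooth[OF J.P_K[OF GK]] p x0 this]
      show ?thesis using H_pdiff[OF upd_mem[OF p x0]] by simp
    qed
    have "((\<lambda>y. cut G (p(w := y)) - (\<Sum>l\<le>s. (p VarX - x0) ^ l / fact l * H l (p(VarX := x0, w := y))))
        has_real_derivative
        (jet_partial w (cut G) p - (\<Sum>l\<le>s. (p VarX - x0) ^ l / fact l * jet_partial w (H l) (p(VarX := x0))))) (at (p w))"
    proof (intro DERIV_diff DERIV_sum DERIV_cmult jet_partial_has_derivative GK p)
      show "((\<lambda>y. H l (p(VarX := x0, w := y))) has_real_derivative jet_partial w (H l) (p(VarX := x0))) (at (p w))" for l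
        using jet_partial_has_derivative[OF HK[of l] upd_mem[OF p x0], of w] by (simp add: w)
    qed
    then have d: "((\<lambda>y. cut G (p(w := y)) - (\<Sum>l\<le>s. (p VarX - x0) ^ l / fact l * H l (p(VarX := x0, w := y))))
        has_real_derivative 0) (at (p w))"
      using taylor by simp
    \<comment> \<open>Along the \<open>w\<close> line \<open>\<psi>\<close> equals \<open>G\<close>
      minus its Taylor polynomial at \<open>x0\<close>, by
      \<open>shifted_polynomial\<close>.\<close>
    have "((\<lambda>y. \<psi> (p(w := y))) has_real_derivative 0) (at (p w))"
      using d
    proof (rule has_field_derivative_transform_within_open)
      show "open (B w)" "p w \<in> B w" using B(1) mem_B[OF p] by auto
      show "cut G (p(w := y)) - (\<Sum>l\<le>s. (p VarX - x0) ^ l / fact l * H l (p(VarX := x0, w := y))) = \<psi> (p(w := y))"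
        if "y \<in> B w" for y
        unfolding \<psi>_def g_def shifted_polynomial using upd_mem[OF p that] by (simp add: w fun_upd_twist)
    qed
    then show "pdiff w \<psi> p = 0" unfolding pdiff_def by (rule DERIV_imp_deriv)
  qed simp
  then show ?thesis
    using \<psi>_smooth g_smooth g_depends le_r_bound[OF assms(1), of k]
    unfolding jet_function_def s_def[symmetric]
    by (intro exI[of _ s] exI[of _ \<psi>] exI[of _ g] conjI) (auto simp: \<psi>_def)
qed

end
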